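(* Let $\mathbf{X}=(X_1,\dots,X_n)$ be a vector of independent random variables with values in a space $\mathcal{X}$, let $\mathbf{X}'$ be an independent copy of $\mathbf{X}$ (i.e. independent of $\mathbf{X}$ and identically distributed to it), let $\mathcal{U}\subseteq\mathbb{R}^d$, and let $\mathcal{H}$ be a finite class of functions $h:\mathcal{X}\to\mathcal{U}$. For $\mathbf{x}\in\mathcal{X}^n$ write $h(\mathbf{x})=(h(x_1),\dots,h(x_n))\in\mathcal{U}^n$ and $\mathcal{H}(\mathbf{x})=\{h(\mathbf{x}):h\in\mathcal{H}\}\subseteq\mathbb{R}^{dn}$. Then for every $f:\mathcal{U}^n\to\mathbb{R}$ $$\mathbb{E}\Big[\sup_{h\in\mathcal{H}}\Big(\mathbb{E}_{\mathbf{X}'}\big[f(h(\mathbf{X}'))\big]-f(h(\mathbf{X}))\Big)\Big]\le\sqrt{2\pi}\,\big(2M_{Lip}(f)+J_{Lip}(f)\big)\,\mathbb{E}\big[G(\mathcal{H}(\mathbf{X}))\big].$$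
   Context: For a set $\mathcal{Z}$, a function $f:\mathcal{Z}^n\to\mathbb{R}$, $k\in\{1,\dots,n\}$ and $y,y'\in\mathcal{Z}$, the $k$-th partial difference operator is $$D^k_{y,y'}f(\mathbf{x})=f(\dots,x_{k-1},y,x_{k+1},\dots)-f(\dots,x_{k-1},y',x_{k+1},\dots),\qquad \mathbf{x}\in\mathcal{Z}^n.$$ For $\mathcal{U}\subseteq\mathbb{R}^d$ and $f:\mathcal{U}^n\to\mathbb{R}$, $$M_{Lip}(f)=\max_k\ \sup_{\mathbf{x}\in\mathcal{U}^n,\ y\ne y'\in\mathcal{U}}\frac{D^k_{y,y'}f(\mathbf{x})}{\|y-y'\|},\qquad J_{Lip}(f)=n\max_{k\ne l}\ \sup_{\mathbf{x}\in\mathcal{U}^n,\ y\ne y',\,z,z'\in\mathcal{U}}\frac{D^l_{z,z'}D^k_{y,y'}f(\mathbf{x})}{\|y-y'\|},$$ where $\|\cdot\|$ is the Euclidean norm. For $Y\subseteq\mathbb{R}^N$, the Gaussian average is $G(Y)=\mathbb{E}\sup_{\mathbf{y}\in Y}\langle\boldsymbol{\gamma},\mathbf{y}\rangle$, where $\boldsymbol{\gamma}$ is a vector of $N$ independent standard normal variables. $\mathbb{E}_{\mathbf{X}'}$ denotes expectation over $\mathbf{X}'$ only. As usual, $\mathcal{X}$ is a measurable space, and the functions $h$ and $f$ are measurable and such that the expectations appearing are defined. *)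

theory Defs
  imports "HOL-Probability.Probability"
begin

definition cart_power :: "'a set \<Rightarrow> ('a ^ 'n) set" where
  "cart_power U = {x. \<forall>k. x $ k \<in> U}"

definition subst_coord :: "'a ^ 'n \<Rightarrow> 'n \<Rightarrow> 'a \<Rightarrow> 'a ^ 'n" where
  "subst_coord x k y = (\<chi> i. if i = k then y else x $ i)"

definition part_diff :: "'n \<Rightarrow> 'a \<Rightarrow> 'a \<Rightarrow> ('a ^ 'n \<Rightarrow> real) \<Rightarrow> 'a ^ 'n \<Rightarrow> real" where
  "part_diff k y y' f x = f (subst_coord x k y) - f (subst_coord x k y')"

text \<open>
  A function on the n-fold power of \<open>U\<close> is represented by a total function; the two seminorms
  below only use its values on \<^term>\<open>cart_power U\<close>. They take values in \<^typ>\<open>ennreal\<close>, so they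
  may be infinite. Exchanging \<open>y\<close> and \<open>y'\<close> changes the sign of the quotients, so
  \<^const>\<open>ennreal\<close> (which maps negative numbers to 0) does not alter the suprema; a supremum
  over the empty set (\<open>U\<close> with at most one point, or only one coordinate in \<open>J_Lip\<close>) is 0.
\<close>

definition M_Lip :: "('a::real_normed_vector) set \<Rightarrow> ('a ^ 'n::finite \<Rightarrow> real) \<Rightarrow> ennreal" where
  "M_Lip U f = (SUP k. Sup {ennreal (part_diff k y y' f x / norm (y - y')) | x y y'.
      x \<in> cart_power U \<and> y \<in> U \<and> y' \<in> U \<and> y \<noteq> y'})"

definition J_Lip :: "('a::real_normed_vector) set \<Rightarrow> ('a ^ 'n::finite \<Rightarrow> real) \<Rightarrow> ennreal" where
  "J_Lip U f = of_nat CARD('n) * (SUP (k, l) \<in> {(k, l). k \<noteq> l}.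
      Sup {ennreal (part_diff l z z' (part_diff k y y' f) x / norm (y - y')) | x y y' z z'.
        x \<in> cart_power U \<and> y \<in> U \<and> y' \<in> U \<and> y \<noteq> y' \<and> z \<in> U \<and> z' \<in> U})"

text \<open>The law of a vector whose coordinates are independent standard normal variables.\<close>

definition std_gaussian :: "('a::euclidean_space) measure" where
  "std_gaussian = distr (\<Pi>\<^sub>M b\<in>Basis. density lborel (\<lambda>t. ennreal (std_normal_density t))) borel
      (\<lambda>g. \<Sum>b\<in>Basis. g b *\<^sub>R b)"

text \<open>
  The supremum and the integral are real-valued, hence meaningful for nonempty bounded \<open>Y\<close>
  (in particular for nonempty finite \<open>Y\<close>).
\<close>

definition gauss_avg :: "('a::euclidean_space) set \<Rightarrow> real" where
  "gauss_avg Y = (\<integral>\<gamma>. (SUP y\<in>Y. \<gamma> \<bullet> y) \<partial>std_gaussian)"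

definition vec_map :: "('x \<Rightarrow> 'a) \<Rightarrow> ('n \<Rightarrow> 'x) \<Rightarrow> 'a ^ 'n" where
  "vec_map h x = (\<chi> k. h (x k))"

end

theory Submission
  imports Defs
begin

text \<open>
  Put \<open>F h x = f (h(x\<^sub>1), \<dots>, h(x\<^sub>n))\<close>. The proof symmetrizes by exchanging single coordinates of
  two independent samples \<open>x\<close>, \<open>x'\<close>, and then trades the resulting random signs for Gaussian
  variables, one coordinate at a time.

  By Jensen's inequality the expected supremum of \<open>\<E> F h - F h x\<close> is at most that of
  \<open>F h x' - F h x\<close>. The joint law of the samples does not change when \<open>x\<^sub>i\<close> and \<open>x'\<^sub>i\<close> are exchanged
  for all \<open>i\<close> outside a set \<open>A\<close>, so one may average over all \<open>2\<^sup>n\<close> sets \<open>A\<close>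
  (\<open>integral_SUP_centered_le_average\<close>). What remains is a statement about two fixed samples: bound
  the average over \<open>A\<close> of \<open>SUP h. q h A\<close>, where \<open>q h A\<close> is the difference of \<open>f\<close> at the two
  complementary mixtures of \<open>h(x)\<close> and \<open>h(x')\<close>. Exchanging \<open>A\<close> with its complement shows
  that \<open>q h\<close> has mean zero over the cube of all \<open>A\<close>.

  The engine is \<open>two_point_gaussian_contraction\<close>. Averaging a supremum over one sign gives half of a
  supremum over pairs \<open>(h, g)\<close>, which sees the signed term \<open>d\<close> only through \<open>d h - d g\<close>; if this is
  dominated by a Euclidean distance \<open>\<parallel>c h - c g\<parallel>\<close>, it is dominated by \<open>sqrt (\<pi>/2)\<close> times the mean
  absolute value of a Gaussian linear form in \<open>c h - c g\<close>, and by the symmetry of the Gaussian law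
  the pair decouples again. Averaging \<open>q\<close> over one coordinate keeps its partial differences in
  the other coordinates under control, so induction
  over the coordinates applies (\<open>hypercube_gaussian_contraction\<close>): each coordinate \<open>k\<close> of the cube leaves
  behind its own independent Gaussian linear form, and \<open>q h\<close> is replaced by its mean, which is zero.

  For the required distance write \<open>s\<^sub>i\<close> for the Euclidean norm of the pair of changes of
  \<open>h(x\<^sub>i)\<close> and \<open>h(x'\<^sub>i)\<close> when \<open>h\<close> is replaced by \<open>g\<close>. The seminorms bound the effect of this
  replacement on the \<open>k\<close>-th partial difference
  by \<open>\<Sum>i. w k i * s\<^sub>i\<close> with \<open>w k i = sqrt 2 * M * [i = k] + J / n\<close>
  (\<open>symmetrized_half_difference_le\<close>). All rows and all columns of \<open>w\<close> sum to
  \<open>C = sqrt 2 * M + J\<close>. The row sums and the Cauchy-Schwarz inequality turn the bound into a Euclidean one with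
  squared weights \<open>C * w k i\<close>; the column sums make the squared weights of the \<open>n\<close> linear forms add up to
  exactly \<open>C\<^sup>2\<close> in every coordinate, so the forms combine to \<open>C\<close> times one standard Gaussian
  vector (\<open>distr_gaussian_rows\<close>). This gives \<open>sqrt (\<pi>/2) * C * (G(H(x)) + G(H(x')))\<close>
  (\<open>average_symmetrized_SUP_le\<close>), and integration yields the constant
  \<open>2 * sqrt (\<pi>/2) * C = sqrt (2 * \<pi>) * (sqrt 2 * M + J)\<close>, which is below the claimed one.

  Infinite seminorms make the right-hand side infinite unless the expected Gaussian average vanishes. In that case
  all \<open>h\<close> agree on the sample almost surely (\<open>gauss_avg_ge_half_distance\<close>), and the left-hand side is zero.
\<close>

section \<open>Finite suprema\<close>

lemma SUP_finite_upper:
  fixes F :: "'h \<Rightarrow> real"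
  assumes "finite T" "h \<in> T"
  shows "F h \<le> (SUP h\<in>T. F h)"
  using assms by (intro cSUP_upper bdd_above_finite) auto

lemma SUP_finite_attained:
  fixes F :: "'h \<Rightarrow> real"
  assumes "finite T" "T \<noteq> {}"
  obtains h where "h \<in> T" "(SUP h\<in>T. F h) = F h"
proof -
  have "(SUP h\<in>T. F h) = Max (F ` T)"
    using assms by (intro cSup_eq_Max) auto
  moreover have "Max (F ` T) \<in> F ` T"
    using assms by (intro Max_in) auto
  ultimately show ?thesis
    using that by auto
qed

lemma integrable_SUP_finite:
  fixes F :: "'h \<Rightarrow> 'a \<Rightarrow> real"
  assumes "finite T" "T \<noteq> {}" "\<And>h. h \<in> T \<Longrightarrow> integrable M (F h)"
  shows "integrable M (\<lambda>x. SUP h\<in>T. F h x)"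
  using assms
proof (induction T rule: finite_ne_induct)
  case (insert a T)
  have "(\<lambda>x. SUP h\<in>insert a T. F h x) = (\<lambda>x. max (F a x) (SUP h\<in>T. F h x))"
    using insert.hyps by (subst cSUP_insert) (auto simp: sup_max)
  then show ?case
    using insert by (auto intro!: integrable_max)
qed simp

lemma measurable_SUP_finite:
  fixes F :: "'h \<Rightarrow> 'a \<Rightarrow> real"
  assumes "finite T" "T \<noteq> {}" "\<And>h. h \<in> T \<Longrightarrow> F h \<in> borel_measurable M"
  shows "(\<lambda>x. SUP h\<in>T. F h x) \<in> borel_measurable M"
  using assms by (intro borel_measurable_cSUP countable_finite bdd_above_finite) auto

section \<open>Products of standard normal distributions\<close>

abbreviation gaussian_product :: "'i set \<Rightarrow> ('i \<Rightarrow> real) measure" where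
  "gaussian_product I \<equiv> PiM I (\<lambda>_. std_normal_distribution)"

lemma prob_space_std_normal: "prob_space std_normal_distribution"
  by (rule prob_space_normal_density) simp

lemma prob_space_gaussian_product: "prob_space (gaussian_product I)"
  by (intro prob_space_PiM prob_space_std_normal)

lemma indep_vars_coordinates:
  assumes "\<And>i. i \<in> I \<Longrightarrow> prob_space (M i)"
  shows "prob_space.indep_vars (PiM I M) M (\<lambda>i x. x i) I"
proof -
  interpret prob_space "PiM I M" by (intro prob_space_PiM assms)
  show ?thesis
  proof (cases "I = {}")
    case True
    show ?thesis unfolding indep_vars_def indep_sets_def using True by auto
  next
    case False
    have "distr (PiM I M) (PiM I M) (\<lambda>x. \<lambda>i\<in>I. x i) = distr (PiM I M) (PiM I M) (\<lambda>x. x)"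
      by (intro distr_cong refl) (auto simp: space_PiM PiE_def extensional_def fun_eq_iff)
    also have "\<dots> = PiM I (\<lambda>i. distr (PiM I M) (M i) (\<lambda>x. x i))"
      using assms by (subst distr_id) (auto intro!: PiM_cong distr_PiM_component[symmetric])
    finally show ?thesis
      using False by (subst indep_vars_iff_distr_eq_PiM') auto
  qed
qed

lemma char_scaled_std_normal:
  "char (distr std_normal_distribution borel (\<lambda>t. a * t)) s = complex_of_real (exp (- (a * s)\<^sup>2 / 2))"
proof -
  have "char (distr std_normal_distribution borel (\<lambda>t. a * t)) s = char std_normal_distribution (s * a)"
    unfolding char_def by (subst integral_distr) (auto simp: mult.assoc)
  then show ?thesis
    by (simp add: char_std_normal_distribution mult.commute)
qed

text \<open>
  The characteristic function of an independent sum is a product, and here it is that of a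
  centred normal variable with variance \<open>\<Sum>i\<in>I. (a i)\<^sup>2\<close>. Working with scaled
  copies of a standard normal variable instead of normal densities covers the degenerate case of variance zero.
\<close>

lemma (in prob_space) distr_gaussian_linear_combination:
  assumes "indep_vars (\<lambda>_. borel) X I"
    and normal: "\<And>i. i \<in> I \<Longrightarrow> distr M borel (X i) = std_normal_distribution"
  shows "distr M borel (\<lambda>\<omega>. \<Sum>i\<in>I. a i * X i \<omega>)
       = distr std_normal_distribution borel (\<lambda>t. sqrt (\<Sum>i\<in>I. (a i)\<^sup>2) * t)"
proof (rule Levy_uniqueness)
  have X[measurable]: "\<And>i. i \<in> I \<Longrightarrow> X i \<in> borel_measurable M"
    using assms(1) by (auto simp: indep_vars_def)
  have indep: "indep_vars (\<lambda>_. borel) (\<lambda>i \<omega>. a i * X i \<omega>) I"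
    by (rule indep_vars_compose2[OF assms(1)]) simp
  show "real_distribution (distr M borel (\<lambda>\<omega>. \<Sum>i\<in>I. a i * X i \<omega>))"
    by (rule real_distribution_distr) simp
  show "real_distribution (distr std_normal_distribution borel (\<lambda>t. sqrt (\<Sum>i\<in>I. (a i)\<^sup>2) * t))"
    by (rule prob_space.real_distribution_distr[OF prob_space_std_normal]) simp
  have coord: "char (distr M borel (\<lambda>\<omega>. a i * X i \<omega>)) s = exp (- (a i * s)\<^sup>2 / 2)"
    if "i \<in> I" for i s
  proof -
    have "distr M borel (\<lambda>\<omega>. a i * X i \<omega>) = distr (distr M borel (X i)) borel (\<lambda>t. a i * t)"
      using that by (subst distr_distr) (auto simp: comp_def)
    then show ?thesis
      using normal[OF that] char_scaled_std_normal[of "a i" s] by simp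
  qed
  show "char (distr M borel (\<lambda>\<omega>. \<Sum>i\<in>I. a i * X i \<omega>))
      = char (distr std_normal_distribution borel (\<lambda>t. sqrt (\<Sum>i\<in>I. (a i)\<^sup>2) * t))"
  proof
    fix s
    have "char (distr M borel (\<lambda>\<omega>. \<Sum>i\<in>I. a i * X i \<omega>)) s
        = (\<Prod>i\<in>I. complex_of_real (exp (- (a i * s)\<^sup>2 / 2)))"
      by (subst char_distr_sum[OF indep]) (auto intro!: prod.cong simp: coord)
    also have "\<dots> = complex_of_real (exp (\<Sum>i\<in>I. - (a i * s)\<^sup>2 / 2))"
      by (cases "finite I") (simp_all add: exp_sum)
    also have "(\<Sum>i\<in>I. - (a i * s)\<^sup>2 / 2) = - (sqrt (\<Sum>i\<in>I. (a i)\<^sup>2) * s)\<^sup>2 / 2"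
      by (simp add: power_mult_distrib sum_nonneg sum_negf sum_distrib_right flip: sum_divide_distrib)
    finally show "char (distr M borel (\<lambda>\<omega>. \<Sum>i\<in>I. a i * X i \<omega>)) s
        = char (distr std_normal_distribution borel (\<lambda>t. sqrt (\<Sum>i\<in>I. (a i)\<^sup>2) * t)) s"
      by (simp add: char_scaled_std_normal)
  qed
qed

lemma indep_vars_gaussian_product:
  "prob_space.indep_vars (gaussian_product I) (\<lambda>_. borel) (\<lambda>i x. x i) I"
proof -
  have "prob_space.indep_vars (gaussian_product I) (\<lambda>_. std_normal_distribution) (\<lambda>i x. x i) I"
    by (rule indep_vars_coordinates) (rule prob_space_std_normal)
  from prob_space.indep_vars_compose2[OF prob_space_gaussian_product this, of "\<lambda>_ t. t" "\<lambda>_. borel"]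
  show ?thesis by simp
qed

lemma distr_gaussian_product_component:
  assumes "i \<in> I"
  shows "distr (gaussian_product I) borel (\<lambda>x. x i) = std_normal_distribution"
proof -
  have "distr (gaussian_product I) borel (\<lambda>x. x i)
      = distr (gaussian_product I) std_normal_distribution (\<lambda>x. x i)"
    by (rule distr_cong) auto
  then show ?thesis
    using distr_PiM_component[of I "\<lambda>_. std_normal_distribution", OF prob_space_std_normal assms]
    by simp
qed

text \<open>
  The \<open>j\<close>-th linear form only involves the variables in row \<open>K \<times> {j}\<close>; the forms are therefore
  independent, and each is normal, so the joint law is determined by the variances.
\<close>

lemma distr_gaussian_rows:
  assumes "J \<noteq> {}"
  shows "distr (gaussian_product (K \<times> J)) (PiM J (\<lambda>_. borel)) (\<lambda>x. \<lambda>j\<in>J. \<Sum>k\<in>K. w k j * x (k, j))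
       = distr (gaussian_product J) (PiM J (\<lambda>_. borel)) (\<lambda>x. \<lambda>j\<in>J. sqrt (\<Sum>k\<in>K. (w k j)\<^sup>2) * x j)"
proof -
  interpret KJ: prob_space "gaussian_product (K \<times> J)" by (rule prob_space_gaussian_product)
  interpret J: prob_space "gaussian_product J" by (rule prob_space_gaussian_product)
  have comp: "(\<lambda>x. x (k, j)) \<in> borel_measurable (gaussian_product (K \<times> J))"
    if "k \<in> K" "j \<in> J" for k j
    using measurable_component_singleton[of "(k, j)" "K \<times> J" "\<lambda>_. std_normal_distribution"] that
    by simp
  have comp': "(\<lambda>x. x j) \<in> borel_measurable (gaussian_product J)" if "j \<in> J" for j
    using measurable_component_singleton[of j J "\<lambda>_. std_normal_distribution"] that
    by simp
  have rows: "KJ.indep_vars (\<lambda>j. PiM (K \<times> {j}) (\<lambda>_. borel))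
      (\<lambda>j x. restrict (\<lambda>i. x i) (K \<times> {j})) J"
    by (rule KJ.indep_vars_restrict[OF indep_vars_gaussian_product])
       (auto simp: disjoint_family_on_def)
  have "KJ.indep_vars (\<lambda>_. borel)
      (\<lambda>j x. \<Sum>k\<in>K. w k j * restrict (\<lambda>i. x i) (K \<times> {j}) (k, j)) J"
    by (rule KJ.indep_vars_compose2[OF rows]) measurable
  then have rows_indep: "KJ.indep_vars (\<lambda>_. borel) (\<lambda>j x. \<Sum>k\<in>K. w k j * x (k, j)) J"
    by (simp cong: sum.cong)
  have "distr (gaussian_product (K \<times> J)) (PiM J (\<lambda>_. borel)) (\<lambda>x. \<lambda>j\<in>J. \<Sum>k\<in>K. w k j * x (k, j))
      = PiM J (\<lambda>j. distr (gaussian_product (K \<times> J)) borel (\<lambda>x. \<Sum>k\<in>K. w k j * x (k, j)))"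
    using rows_indep assms comp by (subst (asm) KJ.indep_vars_iff_distr_eq_PiM') auto
  also have "\<dots> = PiM J (\<lambda>j. distr std_normal_distribution borel (\<lambda>t. sqrt (\<Sum>k\<in>K. (w k j)\<^sup>2) * t))"
  proof (rule PiM_cong[OF refl])
    fix j assume j: "j \<in> J"
    have inj: "KJ.indep_vars (\<lambda>_. borel) (\<lambda>k x. x (k, j)) K"
    proof -
      have "KJ.indep_vars (\<lambda>k. PiM {(k, j)} (\<lambda>_. borel)) (\<lambda>k x. restrict (\<lambda>i. x i) {(k, j)}) K"
        using j by (intro KJ.indep_vars_restrict[OF indep_vars_gaussian_product])
          (auto simp: disjoint_family_on_def)
      from KJ.indep_vars_compose2[OF this, of "\<lambda>k x. x (k, j)" "\<lambda>_. borel"]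
      show ?thesis by simp
    qed
    show "distr (gaussian_product (K \<times> J)) borel (\<lambda>x. \<Sum>k\<in>K. w k j * x (k, j))
        = distr std_normal_distribution borel (\<lambda>t. sqrt (\<Sum>k\<in>K. (w k j)\<^sup>2) * t)"
      using j by (intro KJ.distr_gaussian_linear_combination inj distr_gaussian_product_component) auto
  qed
  also have "\<dots> = PiM J (\<lambda>j. distr (gaussian_product J) borel (\<lambda>x. sqrt (\<Sum>k\<in>K. (w k j)\<^sup>2) * x j))"
  proof (rule PiM_cong[OF refl])
    fix j assume j: "j \<in> J"
    have "distr (gaussian_product J) borel (\<lambda>x. sqrt (\<Sum>k\<in>K. (w k j)\<^sup>2) * x j)
        = distr (distr (gaussian_product J) borel (\<lambda>x. x j)) borel (\<lambda>t. sqrt (\<Sum>k\<in>K. (w k j)\<^sup>2) * t)"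
      using comp'[OF j] by (subst distr_distr) (auto simp: comp_def)
    then show "distr std_normal_distribution borel (\<lambda>t. sqrt (\<Sum>k\<in>K. (w k j)\<^sup>2) * t)
        = distr (gaussian_product J) borel (\<lambda>x. sqrt (\<Sum>k\<in>K. (w k j)\<^sup>2) * x j)"
      using j by (simp add: distr_gaussian_product_component)
  qed
  also have "\<dots> = distr (gaussian_product J) (PiM J (\<lambda>_. borel))
      (\<lambda>x. \<lambda>j\<in>J. sqrt (\<Sum>k\<in>K. (w k j)\<^sup>2) * x j)"
  proof -
    have "J.indep_vars (\<lambda>_. borel) (\<lambda>j x. sqrt (\<Sum>k\<in>K. (w k j)\<^sup>2) * x j) J"
      by (rule J.indep_vars_compose2[OF indep_vars_gaussian_product]) simp
    then show ?thesis
      using assms comp' by (subst (asm) J.indep_vars_iff_distr_eq_PiM') auto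
  qed
  finally show ?thesis .
qed

lemma integrable_gaussian_product_component:
  assumes "i \<in> I"
  shows "integrable (gaussian_product I) (\<lambda>x. x i)"
proof -
  have m: "(\<lambda>x. x i) \<in> borel_measurable (gaussian_product I)"
    using measurable_component_singleton[of i I "\<lambda>_. std_normal_distribution"] assms by simp
  have "integrable (distr (gaussian_product I) borel (\<lambda>x. x i)) (\<lambda>t. t)"
    using integrable_std_normal_distribution_moment[of 1] assms
    by (simp add: distr_gaussian_product_component)
  then show ?thesis
    using m by (subst (asm) integrable_distr_eq) auto
qed

lemma integrable_gaussian_linear_combination:
  "integrable (gaussian_product I) (\<lambda>x. \<Sum>i\<in>I. c i * x i)"
  by (intro Bochner_Integration.integrable_sum integrable_mult_right
      integrable_gaussian_product_component)

text \<open>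
  Up to the factor \<open>sqrt (2 / \<pi>)\<close>, a Euclidean norm is the mean absolute value of a Gaussian linear form.
  Its inverse is the price for replacing a norm by a Gaussian average.
\<close>

lemma integral_abs_gaussian_linear_combination:
  "(\<integral>x. \<bar>\<Sum>i\<in>I. c i * x i\<bar> \<partial>gaussian_product I) = sqrt (2 / pi) * sqrt (\<Sum>i\<in>I. (c i)\<^sup>2)"
proof -
  let ?S = "sqrt (\<Sum>i\<in>I. (c i)\<^sup>2)"
  interpret prob_space "gaussian_product I" by (rule prob_space_gaussian_product)
  have m: "(\<lambda>x. \<Sum>i\<in>I. c i * x i) \<in> borel_measurable (gaussian_product I)"
    using integrable_gaussian_linear_combination by (rule borel_measurable_integrable)
  have law: "distr (gaussian_product I) borel (\<lambda>x. \<Sum>i\<in>I. c i * x i)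
      = distr std_normal_distribution borel (\<lambda>t. ?S * t)"
    by (rule distr_gaussian_linear_combination[OF indep_vars_gaussian_product])
       (rule distr_gaussian_product_component)
  have "(\<integral>x. \<bar>\<Sum>i\<in>I. c i * x i\<bar> \<partial>gaussian_product I)
      = (\<integral>t. \<bar>t\<bar> \<partial>distr (gaussian_product I) borel (\<lambda>x. \<Sum>i\<in>I. c i * x i))"
    using m by (subst integral_distr) auto
  also have "\<dots> = (\<integral>t. \<bar>?S * t\<bar> \<partial>std_normal_distribution)"
    unfolding law by (subst integral_distr) auto
  also have "\<dots> = ?S * (\<integral>t. \<bar>t\<bar> \<partial>std_normal_distribution)"
    by (simp add: abs_mult sum_nonneg)
  also have "(\<integral>t. \<bar>t\<bar> \<partial>std_normal_distribution) = sqrt (2 / pi)"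
    using std_normal_distribution_odd_moments_abs[of 0] by simp
  finally show ?thesis by simp
qed


lemma distr_std_normal_uminus: "distr std_normal_distribution std_normal_distribution uminus = std_normal_distribution"
proof -
  have rd: "real_distribution (distr std_normal_distribution borel (\<lambda>t. a * t))" for a
    by (rule prob_space.real_distribution_distr[OF prob_space_std_normal]) simp
  have "distr std_normal_distribution borel (\<lambda>t. (-1) * t) = distr std_normal_distribution borel (\<lambda>t. 1 * t)"
    by (rule Levy_uniqueness[OF rd rd], rule ext, unfold char_scaled_std_normal) simp
  moreover have "distr std_normal_distribution borel uminus = distr std_normal_distribution std_normal_distribution uminus"
    by (rule distr_cong) auto
  moreover have "distr std_normal_distribution borel (\<lambda>t. t) = distr std_normal_distribution std_normal_distribution (\<lambda>t. t)"
    by (rule distr_cong) auto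
  ultimately show ?thesis
    by (simp add: distr_id)
qed

lemma distr_gaussian_product_uminus:
  assumes "finite I"
  shows "distr (gaussian_product I) (gaussian_product I) (compose I uminus) = gaussian_product I"
  using assms prob_space_std_normal
  by (subst distr_PiM_finite_prob_space') (auto simp: distr_std_normal_uminus)

text \<open>
  The product law is invariant under \<open>x \<mapsto> - x\<close>.
\<close>

lemma integral_gaussian_SUP_uminus:
  assumes "finite I" "finite T" "T \<noteq> {}"
  shows "(\<integral>x. (SUP h\<in>T. B h - (\<Sum>i\<in>I. c h i * x i)) \<partial>gaussian_product I)
       = (\<integral>x. (SUP h\<in>T. B h + (\<Sum>i\<in>I. c h i * x i)) \<partial>gaussian_product I)"
proof -
  let ?F = "\<lambda>x. SUP h\<in>T. B h + (\<Sum>i\<in>I. c h i * x i)"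
  have [measurable]: "(\<lambda>x. x i) \<in> borel_measurable (gaussian_product I)" if "i \<in> I" for i
    using borel_measurable_integrable[OF integrable_gaussian_product_component[OF that]] .
  have F: "?F \<in> borel_measurable (gaussian_product I)"
    using assms by (intro measurable_SUP_finite) auto
  have "(\<integral>x. ?F x \<partial>gaussian_product I)
      = (\<integral>x. ?F x \<partial>distr (gaussian_product I) (gaussian_product I) (compose I uminus))"
    using assms by (simp add: distr_gaussian_product_uminus)
  also have "\<dots> = (\<integral>x. ?F (compose I uminus x) \<partial>gaussian_product I)"
  proof (rule integral_distr)
    show "compose I uminus \<in> gaussian_product I \<rightarrow>\<^sub>M gaussian_product I"
      unfolding compose_def by (rule measurable_restrict) simp
  qed (rule F)
  also have "\<dots> = (\<integral>x. (SUP h\<in>T. B h - (\<Sum>i\<in>I. c h i * x i)) \<partial>gaussian_product I)"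
    by (simp add: compose_def sum_negf cong: sum.cong)
  finally show ?thesis ..
qed

section \<open>Replacing signs by Gaussian variables\<close>

text \<open>
  Fix maximizers \<open>h\<close> and \<open>g\<close> of the two suprema. Their sum is \<open>B h + B g + (d h - d g)\<close>, which is
  bounded by the mean of \<open>B h + B g + \<bar>Z h - Z g\<bar>\<close> for the Gaussian forms \<open>Z\<close> with coefficients
  \<open>c\<close>. Whichever sign the absolute value selects, this is at most the sum of the suprema of
  \<open>B + Z\<close> and of \<open>B - Z\<close>, and these two have the same mean.
\<close>

lemma two_point_gaussian_contraction:
  fixes B d :: "'h \<Rightarrow> real" and c :: "'h \<Rightarrow> 'i \<Rightarrow> real"
  assumes "finite I" "finite T" "T \<noteq> {}"
    and d: "\<And>h g. h \<in> T \<Longrightarrow> g \<in> T \<Longrightarrow>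
          d h - d g \<le> sqrt (2 / pi) * sqrt (\<Sum>i\<in>I. (c h i - c g i)\<^sup>2)"
  shows "((SUP h\<in>T. B h + d h) + (SUP h\<in>T. B h - d h)) / 2
       \<le> (\<integral>x. (SUP h\<in>T. B h + (\<Sum>i\<in>I. c h i * x i)) \<partial>gaussian_product I)"
proof -
  interpret prob_space "gaussian_product I" by (rule prob_space_gaussian_product)
  let ?Z = "\<lambda>h x. \<Sum>i\<in>I. c h i * x i"
  let ?P = "\<lambda>x. SUP h\<in>T. B h + ?Z h x" and ?Q = "\<lambda>x. SUP h\<in>T. B h - ?Z h x"
  note int = integrable_gaussian_linear_combination
  obtain h where h: "h \<in> T" "(SUP h\<in>T. B h + d h) = B h + d h"
    using SUP_finite_attained[OF assms(2,3)] by blast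
  obtain g where g: "g \<in> T" "(SUP h\<in>T. B h - d h) = B g - d g"
    using SUP_finite_attained[OF assms(2,3)] by blast
  have diff: "?Z h x - ?Z g x = (\<Sum>i\<in>I. (c h i - c g i) * x i)" for x
    by (simp add: sum_subtractf algebra_simps)
  have P: "integrable (gaussian_product I) ?P" and Q: "integrable (gaussian_product I) ?Q"
    by (intro integrable_SUP_finite assms Bochner_Integration.integrable_add
        Bochner_Integration.integrable_diff integrable_const int)+
  have D: "integrable (gaussian_product I) (\<lambda>x. \<bar>?Z h x - ?Z g x\<bar>)"
    by (intro integrable_abs Bochner_Integration.integrable_diff int)
  have "(SUP h\<in>T. B h + d h) + (SUP h\<in>T. B h - d h) = B h + B g + (d h - d g)"
    by (simp add: h g)
  also have "\<dots> \<le> B h + B g + (\<integral>x. \<bar>?Z h x - ?Z g x\<bar> \<partial>gaussian_product I)"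
    using d[OF h(1) g(1)] by (simp add: diff integral_abs_gaussian_linear_combination)
  also have "\<dots> = (\<integral>x. B h + B g + \<bar>?Z h x - ?Z g x\<bar> \<partial>gaussian_product I)"
    using D by (simp add: prob_space)
  also have "\<dots> \<le> (\<integral>x. ?P x + ?Q x \<partial>gaussian_product I)"
  proof (rule integral_mono)
    fix x
    have "B h + ?Z h x \<le> ?P x" "B g + ?Z g x \<le> ?P x" "B h - ?Z h x \<le> ?Q x" "B g - ?Z g x \<le> ?Q x"
      using SUP_finite_upper[OF assms(2) h(1), of "\<lambda>h. B h + ?Z h x"]
        SUP_finite_upper[OF assms(2) h(1), of "\<lambda>h. B h - ?Z h x"]
        SUP_finite_upper[OF assms(2) g(1), of "\<lambda>h. B h + ?Z h x"]
        SUP_finite_upper[OF assms(2) g(1), of "\<lambda>h. B h - ?Z h x"] by simp_all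
    then show "B h + B g + \<bar>?Z h x - ?Z g x\<bar> \<le> ?P x + ?Q x"
      by linarith
  qed (use P Q D in auto)
  also have "\<dots> = 2 * (\<integral>x. ?P x \<partial>gaussian_product I)"
    using P Q integral_gaussian_SUP_uminus[OF assms(1-3), of B c] by simp
  finally show ?thesis by simp
qed

lemma sum_Pow_insert:
  assumes "finite K" "k \<notin> K"
  shows "(\<Sum>A\<in>Pow (insert k K). F A) = (\<Sum>A\<in>Pow K. F A + F (insert k A))"
proof -
  have inj: "inj_on (insert k) (Pow K)"
    using assms by (auto simp: inj_on_def)
  have "Pow K \<inter> insert k ` Pow K = {}"
    using assms by auto
  then show ?thesis
    using assms inj by (simp add: Pow_insert sum.union_disjoint sum.reindex sum.distrib)
qed

text \<open>
  The integrability half of Fubini's theorem for a product over a disjoint union of index sets,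
  complementing \<open>product_integral_fold\<close>.
\<close>

lemma (in product_sigma_finite) integrable_product_fold:
  fixes f :: "_ \<Rightarrow> _::{banach, second_countable_topology}"
  assumes "I \<inter> J = {}" and fin: "finite I" "finite J"
    and f: "integrable (Pi\<^sub>M (I \<union> J) M) f"
  shows "integrable (Pi\<^sub>M I M) (\<lambda>x. \<integral>y. f (merge I J (x, y)) \<partial>Pi\<^sub>M J M)"
proof -
  interpret I: finite_product_sigma_finite M I by standard fact
  interpret J: finite_product_sigma_finite M J by standard fact
  interpret P: pair_sigma_finite "Pi\<^sub>M I M" "Pi\<^sub>M J M" ..
  have "integrable (Pi\<^sub>M I M \<Otimes>\<^sub>M Pi\<^sub>M J M) (\<lambda>x. f (merge I J x))"
    by (rule integrable_distr[OF measurable_merge]) (simp add: distr_merge[OF assms(1) fin] f)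
  then show ?thesis
    using P.integrable_fst' by blast
qed

text \<open>
  Induction on \<open>K\<close>, removing the sign of one coordinate \<open>k\<close> at a time. For fixed signs in the other
  coordinates, \<open>q h\<close> is its average \<open>t h\<close> over the sign of \<open>k\<close> plus or minus a half difference;
  the two-point contraction replaces the latter by a Gaussian form, which is then absorbed
  into the arbitrary offset \<open>B\<close>. The average \<open>t h\<close> inherits the hypothesis because its
  partial differences are averages of those of \<open>q h\<close>. The coefficients \<open>c h (k, \<cdot>)\<close> may differ
  from one coordinate to the next, but may not depend on the signs: otherwise the forms already
  introduced could not be treated as an offset in the later steps.
\<close>

lemma hypercube_gaussian_contraction:
  fixes q :: "'h \<Rightarrow> 'k set \<Rightarrow> real" and c :: "'h \<Rightarrow> 'k \<times> 'j \<Rightarrow> real"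
  assumes "finite K" "finite J" "finite T" "T \<noteq> {}"
    and "\<And>k A h g. k \<in> K \<Longrightarrow> A \<subseteq> K - {k} \<Longrightarrow> h \<in> T \<Longrightarrow> g \<in> T \<Longrightarrow>
          (q h (insert k A) - q h A) / 2 - (q g (insert k A) - q g A) / 2
          \<le> sqrt (2 / pi) * sqrt (\<Sum>j\<in>J. (c h (k, j) - c g (k, j))\<^sup>2)"
  shows "(\<Sum>A\<in>Pow K. SUP h\<in>T. B h + q h A) / 2 ^ card K
       \<le> (\<integral>x. (SUP h\<in>T. B h + (\<Sum>A\<in>Pow K. q h A) / 2 ^ card K + (\<Sum>i\<in>K \<times> J. c h i * x i))
            \<partial>gaussian_product (K \<times> J))"
  using assms(1,5)
proof (induction K arbitrary: B q rule: finite_induct)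
  case empty
  interpret prob_space "gaussian_product ({} \<times> J :: ('k \<times> 'j) set)" by (rule prob_space_gaussian_product)
  show ?case by (simp add: prob_space[simplified])
next
  case (insert k K)
  let ?kJ = "{k} \<times> J" and ?KJ = "K \<times> J"
  interpret product_sigma_finite "\<lambda>_ :: 'k \<times> 'j. std_normal_distribution"
    by (intro product_sigma_finite.intro prob_space_imp_sigma_finite prob_space_std_normal)
  have fin: "finite ?kJ" "finite ?KJ" "finite T" "T \<noteq> {}"
    using assms insert.hyps by auto
  define t where "t h A = (q h A + q h (insert k A)) / 2" for h A
  define Z where "Z h I x = (\<Sum>i\<in>I. c h i * x i)" for h I and x :: "'k \<times> 'j \<Rightarrow> real"
  have Zint: "integrable (gaussian_product I) (Z h I)" for h I
    unfolding Z_def by (rule integrable_gaussian_linear_combination)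
  have SUPint: "integrable (gaussian_product I) (\<lambda>x. SUP h\<in>T. b h + Z h I x)" for b I
  proof -
    interpret prob_space "gaussian_product I" by (rule prob_space_gaussian_product)
    show ?thesis
      by (intro integrable_SUP_finite fin Bochner_Integration.integrable_add integrable_const Zint)
  qed
  have step: "((SUP h\<in>T. B h + q h A) + (SUP h\<in>T. B h + q h (insert k A))) / 2
      \<le> (\<integral>x. (SUP h\<in>T. (B h + t h A) + Z h ?kJ x) \<partial>gaussian_product ?kJ)" if A: "A \<in> Pow K" for A
  proof -
    let ?d = "\<lambda>h. (q h (insert k A) - q h A) / 2"
    have AK: "A \<subseteq> insert k K - {k}"
      using A insert.hyps by auto
    have "((SUP h\<in>T. (B h + t h A) + ?d h) + (SUP h\<in>T. (B h + t h A) - ?d h)) / 2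
      \<le> (\<integral>x. (SUP h\<in>T. (B h + t h A) + Z h ?kJ x) \<partial>gaussian_product ?kJ)"
      unfolding Z_def
    proof (rule two_point_gaussian_contraction[OF fin(1,3,4)])
      fix h g assume "h \<in> T" "g \<in> T"
      then show "?d h - ?d g \<le> sqrt (2 / pi) * sqrt (\<Sum>i\<in>?kJ. (c h i - c g i)\<^sup>2)"
        using insert.prems[OF insertI1 AK]
        by (simp add: sum.cartesian_product')
    qed
    moreover have "(B h + t h A) + ?d h = B h + q h (insert k A)" "(B h + t h A) - ?d h = B h + q h A" for h
      by (simp_all add: t_def field_simps)
    ultimately show ?thesis by (simp add: add.commute)
  qed
  have IH: "(\<Sum>A\<in>Pow K. SUP h\<in>T. b h + t h A) / 2 ^ card K
       \<le> (\<integral>y. (SUP h\<in>T. b h + (\<Sum>A\<in>Pow K. t h A) / 2 ^ card K + Z h ?KJ y) \<partial>gaussian_product ?KJ)" for b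
    unfolding Z_def
  proof (rule insert.IH)
    fix l A h g assume l: "l \<in> K" "A \<subseteq> K - {l}" and hg: "h \<in> T" "g \<in> T"
    let ?D = "\<lambda>h A. (q h (insert l A) - q h A) / 2"
    let ?bd = "sqrt (2 / pi) * sqrt (\<Sum>j\<in>J. (c h (l, j) - c g (l, j))\<^sup>2)"
    have "?D h A - ?D g A \<le> ?bd"
      using l hg by (intro insert.prems) auto
    moreover have "?D h (insert k A) - ?D g (insert k A) \<le> ?bd"
      using l hg insert.hyps by (intro insert.prems) auto
    ultimately show "(t h (insert l A) - t h A) / 2 - (t g (insert l A) - t g A) / 2 \<le> ?bd"
      unfolding t_def by (simp add: insert_commute field_simps)
  qed
  (* Averaging over the sign of k first does not change the mean over the whole cube. *)
  let ?m = "\<lambda>h. (\<Sum>A\<in>Pow K. t h A) / 2 ^ card K"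
  have mean: "?m h = (\<Sum>A\<in>Pow (insert k K). q h A) / 2 ^ card (insert k K)" for h
    using insert.hyps by (simp add: sum_Pow_insert t_def sum_divide_distrib field_simps)
  let ?F = "\<lambda>x. SUP h\<in>T. B h + ?m h + Z h (?kJ \<union> ?KJ) x"
  have disj: "?kJ \<inter> ?KJ = {}"
    using insert.hyps by auto
  have merge: "?F (merge ?kJ ?KJ (x, y)) = (SUP h\<in>T. (B h + Z h ?kJ x) + ?m h + Z h ?KJ y)" for x y
  proof -
    have "Z h (?kJ \<union> ?KJ) (merge ?kJ ?KJ (x, y)) = Z h ?kJ x + Z h ?KJ y" for h
      unfolding Z_def sum.union_disjoint[OF fin(1,2) disj] using insert.hyps
      by (intro arg_cong2[where f="(+)"] sum.cong refl) (auto simp: merge_def)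
    then show ?thesis by (simp add: add_ac)
  qed
  have Fint: "integrable (gaussian_product (?kJ \<union> ?KJ)) ?F"
    by (rule SUPint)
  have inner: "integrable (gaussian_product ?kJ) (\<lambda>x. \<integral>y. ?F (merge ?kJ ?KJ (x, y)) \<partial>gaussian_product ?KJ)"
    using fin by (intro integrable_product_fold disj Fint) auto
  have swap: "(B h + t h A) + Z h ?kJ x = (B h + Z h ?kJ x) + t h A" for h A x
    by simp
  have SI: "integrable (gaussian_product ?kJ) (\<lambda>x. SUP h\<in>T. (B h + Z h ?kJ x) + t h A)" for A
    using SUPint[of ?kJ "\<lambda>h. B h + t h A"] unfolding swap .
  have "(\<Sum>A\<in>Pow (insert k K). SUP h\<in>T. B h + q h A) / 2 ^ card (insert k K)
      = (\<Sum>A\<in>Pow K. ((SUP h\<in>T. B h + q h A) + (SUP h\<in>T. B h + q h (insert k A))) / 2) / 2 ^ card K"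
    using insert.hyps by (simp add: sum_Pow_insert sum_divide_distrib field_simps)
  also have "\<dots> \<le> (\<Sum>A\<in>Pow K. \<integral>x. (SUP h\<in>T. (B h + t h A) + Z h ?kJ x) \<partial>gaussian_product ?kJ) / 2 ^ card K"
    by (intro divide_right_mono sum_mono step) auto
  also have "\<dots> = (\<integral>x. (\<Sum>A\<in>Pow K. SUP h\<in>T. (B h + Z h ?kJ x) + t h A) / 2 ^ card K \<partial>gaussian_product ?kJ)"
    using SI by (simp add: swap)
  also have "\<dots> \<le> (\<integral>x. (\<integral>y. ?F (merge ?kJ ?KJ (x, y)) \<partial>gaussian_product ?KJ) \<partial>gaussian_product ?kJ)"
  proof (rule integral_mono)
    show "integrable (gaussian_product ?kJ) (\<lambda>x. (\<Sum>A\<in>Pow K. SUP h\<in>T. (B h + Z h ?kJ x) + t h A) / 2 ^ card K)"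
      using SI by auto
  qed (use inner IH[of "\<lambda>h. B h + Z h ?kJ _"] in \<open>auto simp: merge\<close>)
  also have "\<dots> = (\<integral>x. ?F x \<partial>gaussian_product (?kJ \<union> ?KJ))"
    using fin by (intro product_integral_fold[symmetric] disj Fint) auto
  also have "?kJ \<union> ?KJ = insert k K \<times> J"
    by auto
  finally show ?case
    unfolding Z_def mean .
qed

section \<open>Partial differences and the two seminorms\<close>

lemma part_diff_le_M_Lip:
  fixes f :: "'a::real_normed_vector ^ 'n::finite \<Rightarrow> real"
  assumes fin: "M_Lip U f < \<infinity>" and x: "x \<in> cart_power U" and y: "y \<in> U" "y' \<in> U"
  shows "part_diff k y y' f x \<le> enn2real (M_Lip U f) * norm (y - y')"
proof (cases "y = y'")
  case True
  then show ?thesis by (simp add: part_diff_def)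
next
  case False
  let ?q = "part_diff k y y' f x / norm (y - y')"
  have "ennreal ?q \<le> M_Lip U f"
    unfolding M_Lip_def using x y False by (intro SUP_upper2[of k] Sup_upper) auto
  then have "?q \<le> enn2real (M_Lip U f)"
    using fin by (cases "M_Lip U f") (auto simp: ennreal_le_iff2)
  then show ?thesis
    using False by (simp add: divide_le_eq)
qed

lemma part_diff_part_diff_le_J_Lip:
  fixes f :: "'a::real_normed_vector ^ 'n::finite \<Rightarrow> real"
  assumes fin: "J_Lip U f < \<infinity>" and "k \<noteq> l" and x: "x \<in> cart_power U"
    and y: "y \<in> U" "y' \<in> U" and z: "z \<in> U" "z' \<in> U"
  shows "part_diff l z z' (part_diff k y y' f) x
       \<le> enn2real (J_Lip U f) / CARD('n) * norm (y - y')"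
proof (cases "y = y'")
  case True
  then show ?thesis by (simp add: part_diff_def)
next
  case False
  let ?q = "part_diff l z z' (part_diff k y y' f) x / norm (y - y')"
  have "ennreal ?q \<le> Sup {ennreal (part_diff l z z' (part_diff k y y' f) x / norm (y - y')) | x y y' z z'.
      x \<in> cart_power U \<and> y \<in> U \<and> y' \<in> U \<and> y \<noteq> y' \<and> z \<in> U \<and> z' \<in> U}"
    using x y z False by (intro Sup_upper) blast
  then have "of_nat CARD('n) * ennreal ?q \<le> J_Lip U f"
    unfolding J_Lip_def using \<open>k \<noteq> l\<close>
    by (intro mult_left_mono SUP_upper2[of "(k, l)"]) simp_all
  moreover have "of_nat CARD('n) * ennreal ?q = ennreal (CARD('n) * ?q)"
    by (simp add: ennreal_of_nat_eq_real_of_nat flip: ennreal_mult')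
  ultimately have "CARD('n) * ?q \<le> enn2real (J_Lip U f)"
    using fin by (cases "J_Lip U f") (auto simp: ennreal_le_iff2)
  then have "?q \<le> enn2real (J_Lip U f) / CARD('n)"
    by (simp add: pos_le_divide_eq mult.commute)
  then show ?thesis
    using False by (simp add: divide_le_eq)
qed

lemma subst_coord_commute:
  "k \<noteq> l \<Longrightarrow> subst_coord (subst_coord x k y) l z = subst_coord (subst_coord x l z) k y"
  by (auto simp: subst_coord_def vec_eq_iff)

text \<open>
  The quotient in \<open>J_Lip\<close> measures only the increment in its first coordinate. Commutation lets the
  same seminorm control the dependence on either of the two coordinates.
\<close>

lemma part_diff_commute:
  "k \<noteq> l \<Longrightarrow> part_diff k y y' (part_diff l z z' f) x = part_diff l z z' (part_diff k y y' f) x"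
  by (simp add: part_diff_def subst_coord_commute[of k l])

text \<open>
  Move from \<open>x'\<close> to \<open>x\<close> one coordinate at a time; each step is a second-order partial difference.
  Coordinate \<open>k\<close> can be left out, since \<open>part_diff k\<close> overwrites it.
\<close>

lemma part_diff_change_base_le:
  fixes f :: "'a::real_normed_vector ^ 'n::finite \<Rightarrow> real"
  assumes fin: "J_Lip U f < \<infinity>" and x: "x \<in> cart_power U" "x' \<in> cart_power U"
    and y: "y \<in> U" "y' \<in> U"
  shows "part_diff k y y' f x - part_diff k y y' f x'
       \<le> enn2real (J_Lip U f) / CARD('n) * (\<Sum>i\<in>UNIV - {k}. norm (x $ i - x' $ i))"
proof -
  let ?J = "enn2real (J_Lip U f) / CARD('n)"
  let ?mix = "\<lambda>F. (\<chi> i. if i \<in> F then x $ i else x' $ i)"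
  have "part_diff k y y' f (?mix F) - part_diff k y y' f x' \<le> ?J * (\<Sum>i\<in>F. norm (x $ i - x' $ i))"
    if "finite F" "k \<notin> F" for F
    using that
  proof (induction F rule: finite_induct)
    case empty
    then show ?case by simp
  next
    case (insert l F)
    have mem: "?mix F \<in> cart_power U" "x $ l \<in> U" "x' $ l \<in> U"
      using x by (auto simp: cart_power_def)
    have "?mix (insert l F) = subst_coord (?mix F) l (x $ l)"
      and "?mix F = subst_coord (?mix F) l (x' $ l)"
      using insert.hyps by (auto simp: subst_coord_def vec_eq_iff)
    then have "part_diff k y y' f (?mix (insert l F)) - part_diff k y y' f (?mix F)
        = part_diff l (x $ l) (x' $ l) (part_diff k y y' f) (?mix F)"
      by (simp add: part_diff_def)
    also have "\<dots> = part_diff k y y' (part_diff l (x $ l) (x' $ l) f) (?mix F)"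
      using insert.prems by (subst part_diff_commute) auto
    also have "\<dots> \<le> ?J * norm (x $ l - x' $ l)"
      using insert.prems by (intro part_diff_part_diff_le_J_Lip fin mem y) auto
    finally show ?case
      using insert by (simp add: distrib_left)
  qed
  from this[of "UNIV - {k}"]
  have "part_diff k y y' f (?mix (UNIV - {k})) - part_diff k y y' f x'
      \<le> ?J * (\<Sum>i\<in>UNIV - {k}. norm (x $ i - x' $ i))" by simp
  moreover have "part_diff k y y' f (?mix (UNIV - {k})) = part_diff k y y' f x"
  proof -
    have "subst_coord (?mix (UNIV - {k})) k w = subst_coord x k w" for w
      by (auto simp: subst_coord_def vec_eq_iff)
    then show ?thesis by (simp add: part_diff_def)
  qed
  ultimately show ?thesis by simp
qed

lemma part_diff_difference_le:
  fixes f :: "'a::real_normed_vector ^ 'n::finite \<Rightarrow> real"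
  assumes fin: "M_Lip U f < \<infinity>" "J_Lip U f < \<infinity>" and x: "x \<in> cart_power U" "x' \<in> cart_power U"
    and y: "y \<in> U" "y' \<in> U" and z: "z \<in> U" "z' \<in> U"
  shows "part_diff k y z f x - part_diff k y' z' f x'
       \<le> enn2real (M_Lip U f) * (norm (y - y') + norm (z - z'))
         + enn2real (J_Lip U f) / CARD('n) * (\<Sum>i\<in>UNIV - {k}. norm (x $ i - x' $ i))"
proof -
  have "part_diff k y z f x - part_diff k y' z' f x'
      = part_diff k y y' f x + part_diff k z' z f x
        + (part_diff k y' z' f x - part_diff k y' z' f x')"
    by (simp add: part_diff_def)
  then show ?thesis
    using part_diff_le_M_Lip[OF fin(1) x(1) y, of k] part_diff_le_M_Lip[OF fin(1) x(1) z(2,1), of k]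
      part_diff_change_base_le[OF fin(2) x y(2) z(2), of k]
    by (simp add: distrib_left norm_minus_commute)
qed

section \<open>The bound for two fixed samples\<close>

lemma gauss_avg_eq_gaussian_product:
  fixes V :: "'h \<Rightarrow> 'a::euclidean_space"
  assumes "finite T" "T \<noteq> {}"
  shows "gauss_avg (V ` T) = (\<integral>g. (SUP h\<in>T. \<Sum>b\<in>Basis. (V h \<bullet> b) * g b) \<partial>gaussian_product Basis)"
proof -
  have [measurable]: "(\<lambda>g. g b) \<in> borel_measurable (gaussian_product Basis)" if "b \<in> Basis" for b :: 'a
    using borel_measurable_integrable[OF integrable_gaussian_product_component[OF that]] .
  have "gauss_avg (V ` T) = (\<integral>g. (SUP y\<in>V ` T. (\<Sum>b\<in>Basis. g b *\<^sub>R b) \<bullet> y) \<partial>gaussian_product Basis)"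
    unfolding gauss_avg_def std_gaussian_def
    using assms by (intro integral_distr measurable_SUP_finite) auto
  then show ?thesis
    by (simp add: image_image inner_sum_left inner_commute[of _ "V _"] mult.commute)
qed

definition mix_coords :: "'n set \<Rightarrow> 'a ^ 'n \<Rightarrow> 'a ^ 'n \<Rightarrow> 'a ^ 'n" where
  "mix_coords A x y = (\<chi> i. if i \<in> A then y $ i else x $ i)"

lemma mix_coords_in_cart_power:
  "x \<in> cart_power U \<Longrightarrow> y \<in> cart_power U \<Longrightarrow> mix_coords A x y \<in> cart_power U"
  by (auto simp: mix_coords_def cart_power_def)

lemma sum_Basis_vec:
  "(\<Sum>b\<in>(Basis :: ('a::euclidean_space ^ 'n::finite) set). F b) = (\<Sum>i\<in>UNIV. \<Sum>u\<in>Basis. F (axis i u))"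
proof -
  have "sum F Basis = sum F ((\<lambda>p. axis (fst p) (snd p)) ` (UNIV \<times> Basis))"
    by (rule arg_cong[where f="sum F"]) (force simp: Basis_vec_def)
  moreover have "inj_on (\<lambda>p. axis (fst p) (snd p) :: 'a ^ 'n) (UNIV \<times> Basis)"
    by (auto simp: inj_on_def axis_eq_axis)
  ultimately show ?thesis
    by (simp add: sum.reindex sum.cartesian_product case_prod_beta comp_def)
qed

lemma sum_weighted_le_sqrt:
  fixes w s :: "'i \<Rightarrow> real"
  assumes "\<And>i. i \<in> I \<Longrightarrow> 0 \<le> w i"
  shows "(\<Sum>i\<in>I. w i * s i) \<le> sqrt ((\<Sum>i\<in>I. w i) * (\<Sum>i\<in>I. w i * (s i)\<^sup>2))"
proof (rule real_le_rsqrt)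
  have "(\<Sum>i\<in>I. w i * s i)\<^sup>2 = (\<Sum>i\<in>I. sqrt (w i) * (sqrt (w i) * s i))\<^sup>2"
    using assms by (auto intro!: arg_cong[where f="\<lambda>t. t\<^sup>2"] sum.cong simp flip: mult.assoc)
  also have "\<dots> \<le> (\<Sum>i\<in>I. (sqrt (w i))\<^sup>2) * (\<Sum>i\<in>I. (sqrt (w i) * s i)\<^sup>2)"
    by (rule Cauchy_Schwarz_ineq_sum)
  also have "\<dots> = (\<Sum>i\<in>I. w i) * (\<Sum>i\<in>I. w i * (s i)\<^sup>2)"
    using assms by (auto intro!: arg_cong2[where f="(*)"] sum.cong simp: power_mult_distrib)
  finally show "(\<Sum>i\<in>I. w i * s i)\<^sup>2 \<le> (\<Sum>i\<in>I. w i) * (\<Sum>i\<in>I. w i * (s i)\<^sup>2)" .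
qed

lemma add_le_sqrt2: "x + y \<le> sqrt 2 * sqrt (x\<^sup>2 + y\<^sup>2)" for x y :: real
proof -
  have "(x + y)\<^sup>2 \<le> 2 * (x\<^sup>2 + y\<^sup>2)"
    using sum_squares_bound[of x y] by (simp add: power2_sum)
  then show ?thesis
    by (simp add: real_le_rsqrt flip: real_sqrt_mult)
qed

text \<open>
  Adding \<open>k\<close> to \<open>A\<close> changes coordinate \<open>k\<close> in both complementary mixtures and therefore produces two
  partial differences, whose average is the half difference. Replacing \<open>h\<close> by \<open>g\<close> affects each of
  them through the values inserted at \<open>k\<close>, which costs \<open>M\<close>, and through the other coordinates of the
  base point, which costs \<open>J / n\<close> each. Bounding the change in coordinate \<open>i\<close> by \<open>s h g i\<close>, which takes
  both samples into account, removes the dependence on \<open>A\<close>.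
\<close>

lemma symmetrized_half_difference_le:
  fixes f :: "'a::real_normed_vector ^ 'n::finite \<Rightarrow> real" and a b :: "'h \<Rightarrow> 'a ^ 'n"
  defines "q \<equiv> \<lambda>h A. f (mix_coords A (a h) (b h)) - f (mix_coords (- A) (a h) (b h))"
    and "s \<equiv> \<lambda>h g i. sqrt ((norm (a h $ i - a g $ i))\<^sup>2 + (norm (b h $ i - b g $ i))\<^sup>2)"
  assumes fin: "M_Lip U f < \<infinity>" "J_Lip U f < \<infinity>" and A: "k \<notin> A"
    and h: "a h \<in> cart_power U" "b h \<in> cart_power U"
    and g: "a g \<in> cart_power U" "b g \<in> cart_power U"
  shows "(q h (insert k A) - q h A) / 2 - (q g (insert k A) - q g A) / 2
    \<le> (\<Sum>i\<in>UNIV. (sqrt 2 * enn2real (M_Lip U f) * of_bool (i = k) + enn2real (J_Lip U f) / CARD('n))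
          * s h g i)"
proof -
  let ?M = "enn2real (M_Lip U f)" and ?J = "enn2real (J_Lip U f) / CARD('n)"
  let ?D = "\<lambda>h A. part_diff k (b h $ k) (a h $ k) f (mix_coords A (a h) (b h))"
  have split: "q h (insert k A) - q h A = ?D h A + ?D h (- A)" for h
  proof -
    let ?x = "mix_coords A (a h) (b h)" and ?y = "mix_coords (- A) (a h) (b h)"
    have "mix_coords (insert k A) (a h) (b h) = subst_coord ?x k (b h $ k)"
      "?x = subst_coord ?x k (a h $ k)"
      "?y = subst_coord ?y k (b h $ k)"
      "mix_coords (- insert k A) (a h) (b h) = subst_coord ?y k (a h $ k)"
      using A by (auto simp: mix_coords_def subst_coord_def vec_eq_iff)
    then show ?thesis
      unfolding q_def part_diff_def by simp
  qed
  have norms: "norm (a h $ i - a g $ i) \<le> s h g i" "norm (b h $ i - b g $ i) \<le> s h g i" for i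
    unfolding s_def by (auto intro!: real_le_rsqrt)
  have bound: "?D h A - ?D g A \<le> sqrt 2 * ?M * s h g k + ?J * (\<Sum>i\<in>UNIV. s h g i)" for A
  proof -
    have "?D h A - ?D g A \<le> ?M * (norm (b h $ k - b g $ k) + norm (a h $ k - a g $ k))
        + ?J * (\<Sum>i\<in>UNIV - {k}. norm (mix_coords A (a h) (b h) $ i - mix_coords A (a g) (b g) $ i))"
      using h g by (intro part_diff_difference_le fin mix_coords_in_cart_power)
        (auto simp: cart_power_def)
    also have "\<dots> \<le> ?M * (sqrt 2 * s h g k) + ?J * (\<Sum>i\<in>UNIV. s h g i)"
    proof (intro add_mono mult_left_mono)
      show "norm (b h $ k - b g $ k) + norm (a h $ k - a g $ k) \<le> sqrt 2 * s h g k"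
        using add_le_sqrt2[of "norm (a h $ k - a g $ k)" "norm (b h $ k - b g $ k)"]
        by (simp add: s_def add.commute)
      show "(\<Sum>i\<in>UNIV - {k}. norm (mix_coords A (a h) (b h) $ i - mix_coords A (a g) (b g) $ i))
          \<le> (\<Sum>i\<in>UNIV. s h g i)"
        by (rule order_trans[OF sum_mono sum_mono2]) (auto simp: mix_coords_def norms s_def)
    qed auto
    finally show ?thesis by (simp add: mult_ac)
  qed
  have "(q h (insert k A) - q h A) / 2 - (q g (insert k A) - q g A) / 2
      = ((?D h A - ?D g A) + (?D h (- A) - ?D g (- A))) / 2"
    unfolding split by (simp add: field_simps)
  also have "\<dots> \<le> sqrt 2 * ?M * s h g k + ?J * (\<Sum>i\<in>UNIV. s h g i)"
    using add_mono[OF bound[of A] bound[of "- A"]] by (simp only: divide_le_eq_numeral1 mult_2_right)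
  also have "\<dots> = (\<Sum>i\<in>UNIV. (sqrt 2 * ?M * of_bool (i = k) + ?J) * s h g i)"
  proof -
    have "(\<Sum>i\<in>UNIV. sqrt 2 * ?M * of_bool (i = k) * s h g i)
        = (\<Sum>i\<in>UNIV. if i = k then sqrt 2 * ?M * s h g i else 0)"
      by (intro sum.cong) auto
    then show ?thesis
      by (simp add: distrib_right sum.distrib sum_distrib_left)
  qed
  finally show ?thesis .
qed

text \<open>
  The forms for the two samples use disjoint blocks of variables, indexed by the second component.
  On its own, each block is a standard Gaussian vector.
\<close>

lemma integral_gaussian_product_marginal:
  fixes V :: "'h \<Rightarrow> 'a::euclidean_space"
  assumes "finite T" "T \<noteq> {}"
  shows "(\<integral>x. (SUP h\<in>T. \<Sum>b\<in>Basis. (V h \<bullet> b) * x (b, s)) \<partial>gaussian_product (Basis \<times> (UNIV :: 'c set)))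
       = gauss_avg (V ` T)"
    and "integrable (gaussian_product (Basis \<times> (UNIV :: 'c set)))
        (\<lambda>x. SUP h\<in>T. \<Sum>b\<in>Basis. (V h \<bullet> b) * x (b, s))"
proof -
  let ?G = "gaussian_product (Basis \<times> (UNIV :: 'c set)) :: ('a \<times> 'c \<Rightarrow> real) measure"
  let ?F = "\<lambda>g. SUP h\<in>T. \<Sum>b\<in>Basis. (V h \<bullet> b) * g b"
  have [measurable]: "(\<lambda>g. g b) \<in> borel_measurable (gaussian_product Basis)" if "b \<in> Basis" for b :: 'a
    using borel_measurable_integrable[OF integrable_gaussian_product_component[OF that]] .
  have F: "?F \<in> borel_measurable (gaussian_product Basis)"
    using assms by (intro measurable_SUP_finite) auto
  have m: "(\<lambda>x. \<lambda>b\<in>Basis. x (b, s)) \<in> ?G \<rightarrow>\<^sub>M gaussian_product Basis"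
    by (intro measurable_restrict measurable_component_singleton) simp
  have "distr ?G (gaussian_product Basis) (\<lambda>x. \<lambda>b\<in>Basis. x (b, s)) = gaussian_product Basis"
    by (rule distr_PiM_reindex) (auto simp: prob_space_std_normal inj_on_def)
  then have "gauss_avg (V ` T) = (\<integral>g. ?F g \<partial>distr ?G (gaussian_product Basis) (\<lambda>x. \<lambda>b\<in>Basis. x (b, s)))"
    using assms by (simp add: gauss_avg_eq_gaussian_product)
  also have "\<dots> = (\<integral>x. ?F (\<lambda>b\<in>Basis. x (b, s)) \<partial>?G)"
    by (rule integral_distr[OF m F])
  finally show "(\<integral>x. (SUP h\<in>T. \<Sum>b\<in>Basis. (V h \<bullet> b) * x (b, s)) \<partial>?G) = gauss_avg (V ` T)"
    by (simp cong: sum.cong)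
  show "integrable ?G (\<lambda>x. SUP h\<in>T. \<Sum>b\<in>Basis. (V h \<bullet> b) * x (b, s))"
    using assms by (intro integrable_SUP_finite Bochner_Integration.integrable_sum
      integrable_mult_right integrable_gaussian_product_component) auto
qed

text \<open>
  The vectors \<open>a h\<close> and \<open>b h\<close> are the images of the two samples. The squared weight attached to step \<open>k\<close> and to a basis
  direction in coordinate \<open>i\<close> is \<open>C * w k i\<close>. Since rows and columns of \<open>w\<close> have the same sum
  \<open>C\<close>, this choice meets the hypothesis of the hypercube contraction in every step and makes the
  steps add up to the isotropic squared weight \<open>C\<^sup>2\<close>.
\<close>

lemma average_symmetrized_SUP_le:
  fixes f :: "'a::euclidean_space ^ 'n::finite \<Rightarrow> real" and a b :: "'h \<Rightarrow> 'a ^ 'n"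
  assumes fin: "M_Lip U f < \<infinity>" "J_Lip U f < \<infinity>" and T: "finite T" "T \<noteq> {}"
    and a: "\<And>h. h \<in> T \<Longrightarrow> a h \<in> cart_power U" and b: "\<And>h. h \<in> T \<Longrightarrow> b h \<in> cart_power U"
  shows "(\<Sum>A\<in>UNIV. SUP h\<in>T. f (mix_coords A (a h) (b h)) - f (mix_coords (- A) (a h) (b h))) / 2 ^ CARD('n)
       \<le> sqrt (pi / 2) * (sqrt 2 * enn2real (M_Lip U f) + enn2real (J_Lip U f))
         * (gauss_avg (a ` T) + gauss_avg (b ` T))"
proof -
  define M where "M = enn2real (M_Lip U f)"
  define J where "J = enn2real (J_Lip U f)"
  define C where "C = sqrt 2 * M + J"
  have nonneg: "0 \<le> M" "0 \<le> J" "0 \<le> C"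
    by (simp_all add: M_def J_def C_def)
  define w where "w k i = sqrt 2 * M * of_bool (i = k) + J / CARD('n)" for k i :: 'n
  have w_nonneg: "0 \<le> w k i" for k i
    using nonneg by (simp add: w_def)
  have w_row: "(\<Sum>i\<in>UNIV. w k i) = C" and w_col: "(\<Sum>k\<in>UNIV. w k i) = C" for k i
    by (simp_all add: w_def C_def sum.distrib sum_distrib_left[symmetric] of_bool_def)
  (* A basis vector of the n-fold power lies in exactly one coordinate; row recovers it. *)
  define row where "row = (\<lambda>v :: 'a ^ 'n. SOME i. \<exists>u\<in>Basis. v = axis i u)"
  have row: "row (axis i u) = i" if "u \<in> Basis" for i u
    unfolding row_def using that by (intro some_equality) (auto simp: axis_eq_axis)
  (* The Boolean tags the sample: False for a, True for b. *)
  define V where "V h s = (if s then b h else a h)" for h s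
  let ?J = "(Basis :: ('a ^ 'n) set) \<times> (UNIV :: bool set)"
  define r where "r k j = sqrt (C * w k (row (fst j)))" for k and j :: "('a ^ 'n) \<times> bool"
  (* The factor sqrt (pi / 2) cancels the mean absolute value of a standard normal variable. *)
  define c where "c h = (\<lambda>(k, j). sqrt (pi / 2) * r k j * (V h (snd j) \<bullet> fst j))" for h
  define q where "q h A = f (mix_coords A (a h) (b h)) - f (mix_coords (- A) (a h) (b h))" for h A
  let ?F = "\<lambda>y. SUP h\<in>T. sqrt (pi / 2) * (\<Sum>j\<in>?J. (V h (snd j) \<bullet> fst j) * y j)"
  let ?G = "\<lambda>s x. SUP h\<in>T. \<Sum>v\<in>Basis. (V h s \<bullet> v) * x (v, s)"
  have F: "?F \<in> borel_measurable (PiM ?J (\<lambda>_. borel))"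
    using T by (intro measurable_SUP_finite borel_measurable_times borel_measurable_sum
      borel_measurable_const measurable_component_singleton)
  have "(\<Sum>A\<in>Pow UNIV. SUP h\<in>T. 0 + q h A) / 2 ^ card (UNIV :: 'n set)
     \<le> (\<integral>x. (SUP h\<in>T. 0 + (\<Sum>A\<in>Pow UNIV. q h A) / 2 ^ card (UNIV :: 'n set) + (\<Sum>i\<in>UNIV \<times> ?J. c h i * x i))
            \<partial>gaussian_product (UNIV \<times> ?J))"
  proof (rule hypercube_gaussian_contraction[OF finite _ T])
    fix k :: 'n and A h g assume "A \<subseteq> UNIV - {k}" and hg: "h \<in> T" "g \<in> T"
    then have A: "k \<notin> A" by auto
    define s where "s i = sqrt ((norm (a h $ i - a g $ i))\<^sup>2 + (norm (b h $ i - b g $ i))\<^sup>2)" for i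
    have term_eq: "(c h (k, (v, t)) - c g (k, (v, t)))\<^sup>2
        = pi / 2 * (C * w k (row v)) * ((V h t - V g t) \<bullet> v)\<^sup>2" for v t
    proof -
      have "c h (k, (v, t)) - c g (k, (v, t)) = sqrt (pi / 2) * r k (v, t) * ((V h t - V g t) \<bullet> v)"
        by (simp add: c_def inner_diff_left right_diff_distrib)
      then show ?thesis
        using nonneg w_nonneg by (simp add: power_mult_distrib r_def)
    qed
    have "(\<Sum>j\<in>?J. (c h (k, j) - c g (k, j))\<^sup>2)
        = (\<Sum>v\<in>Basis. pi / 2 * C * w k (row v) * (((a h - a g) \<bullet> v)\<^sup>2 + ((b h - b g) \<bullet> v)\<^sup>2))"
      unfolding sum.cartesian_product' term_eq
      by (simp add: UNIV_bool V_def distrib_left mult.assoc add.commute)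
    also have "\<dots> = pi / 2 * (C * (\<Sum>i\<in>UNIV. w k i * (s i)\<^sup>2))"
    proof -
      have sq: "(\<Sum>u\<in>Basis. (x \<bullet> u)\<^sup>2) = (norm x)\<^sup>2" for x :: 'a
        unfolding power2_norm_eq_inner by (subst euclidean_inner) (simp add: power2_eq_square)
      have "(\<Sum>v\<in>Basis. pi / 2 * C * w k (row v) * (((a h - a g) \<bullet> v)\<^sup>2 + ((b h - b g) \<bullet> v)\<^sup>2))
          = (\<Sum>i\<in>UNIV. pi / 2 * C * w k i *
              (\<Sum>u\<in>Basis. ((a h $ i - a g $ i) \<bullet> u)\<^sup>2 + ((b h $ i - b g $ i) \<bullet> u)\<^sup>2))"
        unfolding sum_Basis_vec sum_distrib_left by (intro sum.cong refl) (simp add: row inner_axis)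
      then show ?thesis
        by (simp add: sum.distrib sq s_def sum_distrib_left mult.assoc)
    qed
    finally have "sqrt (2 / pi) * sqrt (\<Sum>j\<in>?J. (c h (k, j) - c g (k, j))\<^sup>2)
        = sqrt (C * (\<Sum>i\<in>UNIV. w k i * (s i)\<^sup>2))"
      by (simp add: field_simps flip: real_sqrt_mult)
    moreover have "(q h (insert k A) - q h A) / 2 - (q g (insert k A) - q g A) / 2
        \<le> (\<Sum>i\<in>UNIV. w k i * s i)"
      unfolding q_def w_def s_def M_def J_def
      using hg by (intro symmetrized_half_difference_le fin A a b)
    moreover have "\<dots> \<le> sqrt (C * (\<Sum>i\<in>UNIV. w k i * (s i)\<^sup>2))"
      using sum_weighted_le_sqrt[of UNIV "w k" s] w_nonneg by (simp add: w_row)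
    ultimately show "(q h (insert k A) - q h A) / 2 - (q g (insert k A) - q g A) / 2
        \<le> sqrt (2 / pi) * sqrt (\<Sum>j\<in>?J. (c h (k, j) - c g (k, j))\<^sup>2)"
      by simp
  qed simp
  also have "(\<lambda>h. (\<Sum>A\<in>Pow UNIV. q h A)) = (\<lambda>h. 0)"
  proof
    fix h
    have "(\<Sum>A\<in>UNIV. f (mix_coords (- A) (a h) (b h))) = (\<Sum>A\<in>UNIV. f (mix_coords A (a h) (b h)))"
      by (rule sum.reindex_bij_witness[of _ uminus uminus]) auto
    then show "(\<Sum>A\<in>Pow UNIV. q h A) = 0"
      by (simp add: q_def sum_subtractf)
  qed
  finally have "(\<Sum>A\<in>UNIV. SUP h\<in>T. q h A) / 2 ^ CARD('n)
     \<le> (\<integral>x. (SUP h\<in>T. \<Sum>i\<in>UNIV \<times> ?J. c h i * x i) \<partial>gaussian_product (UNIV \<times> ?J))"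
    by simp
  also have "\<dots> = (\<integral>x. (SUP h\<in>T. sqrt (pi / 2) * (\<Sum>j\<in>?J. (V h (snd j) \<bullet> fst j) *
        (\<Sum>k\<in>UNIV. r k j * x (k, j)))) \<partial>gaussian_product (UNIV \<times> ?J))"
  proof -
    have "(\<Sum>i\<in>UNIV \<times> ?J. c h i * x i)
        = sqrt (pi / 2) * (\<Sum>j\<in>?J. (V h (snd j) \<bullet> fst j) * (\<Sum>k\<in>UNIV. r k j * x (k, j)))" for h x
    proof -
      have "(\<Sum>i\<in>UNIV \<times> ?J. c h i * x i) = (\<Sum>k\<in>UNIV. \<Sum>j\<in>?J. c h (k, j) * x (k, j))"
        by (rule sum.cartesian_product')
      also have "\<dots> = (\<Sum>j\<in>?J. \<Sum>k\<in>UNIV. c h (k, j) * x (k, j))"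
        by (rule sum.swap)
      finally show ?thesis
        unfolding sum_distrib_left by (simp add: c_def mult_ac)
    qed
    then show ?thesis by simp
  qed
  also have "\<dots> = (\<integral>x. ?F (\<lambda>j\<in>?J. \<Sum>k\<in>UNIV. r k j * x (k, j)) \<partial>gaussian_product (UNIV \<times> ?J))"
    by (simp cong: sum.cong)
  also have "\<dots> = (\<integral>y. ?F y \<partial>distr (gaussian_product (UNIV \<times> ?J)) (PiM ?J (\<lambda>_. borel))
      (\<lambda>x. \<lambda>j\<in>?J. \<Sum>k\<in>UNIV. r k j * x (k, j)))"
  proof (rule integral_distr[OF _ F, symmetric])
    have "(\<lambda>x. x (k, j)) \<in> borel_measurable (gaussian_product (UNIV \<times> ?J))" if "j \<in> ?J" for k :: 'n and j
      using that by (intro borel_measurable_integrable[OF integrable_gaussian_product_component]) auto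
    then show "(\<lambda>x. \<lambda>j\<in>?J. \<Sum>k\<in>UNIV. r k j * x (k, j))
        \<in> gaussian_product (UNIV \<times> ?J) \<rightarrow>\<^sub>M PiM ?J (\<lambda>_. borel)"
      by (intro measurable_restrict borel_measurable_sum borel_measurable_times borel_measurable_const)
  qed
  also have "\<dots> = (\<integral>y. ?F y \<partial>distr (gaussian_product ?J) (PiM ?J (\<lambda>_. borel))
      (\<lambda>x. \<lambda>j\<in>?J. sqrt (\<Sum>k\<in>UNIV. (r k j)\<^sup>2) * x j))"
    by (subst distr_gaussian_rows) auto
  also have "\<dots> = (\<integral>x. ?F (\<lambda>j\<in>?J. sqrt (\<Sum>k\<in>UNIV. (r k j)\<^sup>2) * x j) \<partial>gaussian_product ?J)"
  proof (rule integral_distr[OF _ F])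
    have "(\<lambda>x. x j) \<in> borel_measurable (gaussian_product ?J)" if "j \<in> ?J" for j
      using that by (intro borel_measurable_integrable[OF integrable_gaussian_product_component])
    then show "(\<lambda>x. \<lambda>j\<in>?J. sqrt (\<Sum>k\<in>UNIV. (r k j)\<^sup>2) * x j)
        \<in> gaussian_product ?J \<rightarrow>\<^sub>M PiM ?J (\<lambda>_. borel)"
      by (intro measurable_restrict borel_measurable_times borel_measurable_const)
  qed
  also have "\<dots> \<le> (\<integral>x. sqrt (pi / 2) * C * (?G False x + ?G True x) \<partial>gaussian_product ?J)"
  proof (rule integral_mono)
    have sqr: "sqrt (\<Sum>k\<in>UNIV. (r k j)\<^sup>2) = C" for j
      using nonneg w_nonneg by (simp add: r_def w_col flip: sum_distrib_left)
    have eq: "sqrt (pi / 2) * (\<Sum>j\<in>?J. (V h (snd j) \<bullet> fst j) * (\<lambda>j\<in>?J. sqrt (\<Sum>k\<in>UNIV. (r k j)\<^sup>2) * x j) j)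
        = sqrt (pi / 2) * C * ((\<Sum>v\<in>Basis. (V h False \<bullet> v) * x (v, False)) + (\<Sum>v\<in>Basis. (V h True \<bullet> v) * x (v, True)))"
      for h and x :: "('a ^ 'n) \<times> bool \<Rightarrow> real"
    proof -
      have "(\<Sum>j\<in>?J. (V h (snd j) \<bullet> fst j) * (\<lambda>j\<in>?J. sqrt (\<Sum>k\<in>UNIV. (r k j)\<^sup>2) * x j) j)
          = (\<Sum>j\<in>?J. C * ((V h (snd j) \<bullet> fst j) * x j))"
        by (intro sum.cong refl) (auto simp: sqr)
      then show ?thesis
        by (simp add: sum.cartesian_product' UNIV_bool sum.distrib distrib_left mult.assoc
            flip: sum_distrib_left)
    qed
    show "integrable (gaussian_product ?J) (\<lambda>x. ?F (\<lambda>j\<in>?J. sqrt (\<Sum>k\<in>UNIV. (r k j)\<^sup>2) * x j))"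
      unfolding eq using T
      by (intro integrable_SUP_finite integrable_mult_right Bochner_Integration.integrable_add
          Bochner_Integration.integrable_sum integrable_gaussian_product_component) auto
    show "integrable (gaussian_product ?J) (\<lambda>x. sqrt (pi / 2) * C * (?G False x + ?G True x))"
      by (intro integrable_mult_right Bochner_Integration.integrable_add
          integral_gaussian_product_marginal(2)[OF T])
    fix x
    show "?F (\<lambda>j\<in>?J. sqrt (\<Sum>k\<in>UNIV. (r k j)\<^sup>2) * x j) \<le> sqrt (pi / 2) * C * (?G False x + ?G True x)"
      unfolding eq using T nonneg
      by (intro cSUP_least mult_left_mono add_mono SUP_finite_upper) auto
  qed
  also have "\<dots> = sqrt (pi / 2) * C * (gauss_avg (a ` T) + gauss_avg (b ` T))"
    using integral_gaussian_product_marginal[OF T, of a False]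
      integral_gaussian_product_marginal[OF T, of b True]
    by (simp add: V_def)
  finally show ?thesis
    by (simp add: q_def C_def M_def J_def)
qed

section \<open>Symmetrization by exchanging coordinates\<close>

text \<open>
  Two independent samples are one point \<open>\<omega>\<close> of the product over \<open>n \<times> {False, True}\<close>. The sample
  selected by \<open>A\<close> takes the copy tagged \<open>True\<close> exactly in the coordinates from \<open>A\<close>, so
  \<open>select_copy A\<close> and \<open>select_copy (- A)\<close> use disjoint sets of variables, and exchanging
  coordinates becomes a permutation of the index set.
\<close>

definition select_copy :: "'n set \<Rightarrow> ('n \<times> bool \<Rightarrow> 'x) \<Rightarrow> 'n \<Rightarrow> 'x" where
  "select_copy A \<omega> = (\<lambda>k. \<omega> (k, k \<in> A))"

abbreviation doubled :: "('n \<Rightarrow> 'x measure) \<Rightarrow> ('n \<times> bool) set \<Rightarrow> ('n \<times> bool \<Rightarrow> 'x) measure" where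
  "doubled \<mu> K \<equiv> PiM K (\<lambda>p. \<mu> (fst p))"

context
  fixes \<mu> :: "'n::finite \<Rightarrow> 'x measure"
  assumes \<mu>: "\<And>k. prob_space (\<mu> k)"
begin

lemma distr_select_copy:
  assumes "\<And>k. (k, k \<in> A) \<in> K"
  shows "distr (doubled \<mu> K) (PiM UNIV \<mu>) (select_copy A) = PiM UNIV \<mu>"
  using distr_PiM_reindex[of K "\<lambda>p. \<mu> (fst p)" "\<lambda>k. (k, k \<in> A)" UNIV] \<mu> assms
  by (auto simp: inj_on_def select_copy_def[abs_def] restrict_UNIV)

lemma measurable_select_copy:
  assumes "\<And>k. (k, k \<in> A) \<in> K"
  shows "select_copy A \<in> doubled \<mu> K \<rightarrow>\<^sub>M PiM UNIV \<mu>"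
proof -
  have "(\<lambda>\<omega>. \<lambda>k\<in>UNIV. \<omega> (k, k \<in> A)) \<in> doubled \<mu> K \<rightarrow>\<^sub>M PiM UNIV \<mu>"
    using assms measurable_component_singleton[of "(_, _ \<in> A)" K "\<lambda>p. \<mu> (fst p)"]
    by (intro measurable_restrict) auto
  then show ?thesis
    by (simp add: select_copy_def[abs_def] restrict_UNIV)
qed

lemma integral_select_copy:
  fixes F :: "('n \<Rightarrow> 'x) \<Rightarrow> real"
  assumes "\<And>k. (k, k \<in> A) \<in> K" "F \<in> borel_measurable (PiM UNIV \<mu>)"
  shows "(\<integral>\<omega>. F (select_copy A \<omega>) \<partial>doubled \<mu> K) = (\<integral>x. F x \<partial>PiM UNIV \<mu>)"
  using integral_distr[OF measurable_select_copy[OF assms(1)] assms(2)]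
  by (simp add: distr_select_copy assms(1))

lemma integrable_select_copy:
  fixes F :: "('n \<Rightarrow> 'x) \<Rightarrow> real"
  assumes "\<And>k. (k, k \<in> A) \<in> K" "integrable (PiM UNIV \<mu>) F"
  shows "integrable (doubled \<mu> K) (\<lambda>\<omega>. F (select_copy A \<omega>))"
  using assms by (intro integrable_distr[OF measurable_select_copy]) (auto simp: distr_select_copy)

text \<open>
  The reindexing that flips the tag in the coordinates outside \<open>A\<close> preserves the product
  measure, since both copies of a coordinate have the same law.
\<close>

lemma integral_swap_copies:
  fixes F :: "('n \<Rightarrow> 'x) \<Rightarrow> ('n \<Rightarrow> 'x) \<Rightarrow> real"
  assumes F: "(\<lambda>\<omega>. F (select_copy UNIV \<omega>) (select_copy {} \<omega>)) \<in> borel_measurable (doubled \<mu> UNIV)"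
  shows "(\<integral>\<omega>. F (select_copy A \<omega>) (select_copy (- A) \<omega>) \<partial>doubled \<mu> UNIV)
       = (\<integral>\<omega>. F (select_copy UNIV \<omega>) (select_copy {} \<omega>) \<partial>doubled \<mu> UNIV)"
proof -
  define \<theta> where "\<theta> = (\<lambda>\<omega> :: 'n \<times> bool \<Rightarrow> 'x. \<lambda>p\<in>UNIV. \<omega> (fst p, snd p = (fst p \<in> A)))"
  have "inj (\<lambda>p :: 'n \<times> bool. (fst p, snd p = (fst p \<in> A)))"
    by (rule injI, simp only: prod_eq_iff fst_conv snd_conv, erule conjE, simp, blast)
  from distr_PiM_reindex[OF \<mu> this, of UNIV fst]
  have law: "distr (doubled \<mu> UNIV) (doubled \<mu> UNIV) \<theta> = doubled \<mu> UNIV"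
    unfolding \<theta>_def by simp
  have m: "\<theta> \<in> doubled \<mu> UNIV \<rightarrow>\<^sub>M doubled \<mu> UNIV"
    unfolding \<theta>_def
  proof (rule measurable_restrict)
    fix p :: "'n \<times> bool"
    show "(\<lambda>\<omega>. \<omega> (fst p, snd p = (fst p \<in> A))) \<in> doubled \<mu> UNIV \<rightarrow>\<^sub>M \<mu> (fst p)"
      using measurable_component_singleton[of "(fst p, snd p = (fst p \<in> A))" UNIV "\<lambda>p. \<mu> (fst p)"]
      by simp
  qed
  have "(\<integral>\<omega>. F (select_copy UNIV \<omega>) (select_copy {} \<omega>) \<partial>doubled \<mu> UNIV)
      = (\<integral>\<omega>. F (select_copy UNIV \<omega>) (select_copy {} \<omega>) \<partial>distr (doubled \<mu> UNIV) (doubled \<mu> UNIV) \<theta>)"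
    by (simp only: law)
  also have "\<dots> = (\<integral>\<omega>. F (select_copy UNIV (\<theta> \<omega>)) (select_copy {} (\<theta> \<omega>)) \<partial>doubled \<mu> UNIV)"
    by (rule integral_distr[OF m F])
  also have "\<dots> = (\<integral>\<omega>. F (select_copy A \<omega>) (select_copy (- A) \<omega>) \<partial>doubled \<mu> UNIV)"
    by (simp add: select_copy_def \<theta>_def)
  finally show ?thesis ..
qed

text \<open>
  Jensen's inequality for the supremum: integrate over the copies tagged \<open>True\<close> with the other copies
  fixed.
\<close>

lemma integral_SUP_centered_le_copies:
  fixes F :: "'h \<Rightarrow> ('n \<Rightarrow> 'x) \<Rightarrow> real"
  assumes T: "finite T" "T \<noteq> {}" and F: "\<And>h. h \<in> T \<Longrightarrow> integrable (PiM UNIV \<mu>) (F h)"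
  shows "(\<integral>x. (SUP h\<in>T. (\<integral>y. F h y \<partial>PiM UNIV \<mu>) - F h x) \<partial>PiM UNIV \<mu>)
       \<le> (\<integral>\<omega>. (SUP h\<in>T. F h (select_copy UNIV \<omega>) - F h (select_copy {} \<omega>)) \<partial>doubled \<mu> UNIV)"
proof -
  interpret Q: prob_space "PiM UNIV \<mu>" by (intro prob_space_PiM \<mu>)
  interpret product_sigma_finite "\<lambda>p :: 'n \<times> bool. \<mu> (fst p)"
    by (intro product_sigma_finite.intro prob_space_imp_sigma_finite \<mu>)
  let ?I = "UNIV \<times> {False} :: ('n \<times> bool) set" and ?J = "UNIV \<times> {True} :: ('n \<times> bool) set"
  interpret J: prob_space "doubled \<mu> ?J" by (intro prob_space_PiM \<mu>)
  have disj: "?I \<inter> ?J = {}" and un: "?I \<union> ?J = UNIV"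
    by (auto simp: UNIV_Times_UNIV[symmetric] UNIV_bool simp del: UNIV_Times_UNIV)
  define m where "m h = (\<integral>y. F h y \<partial>PiM UNIV \<mu>)" for h
  let ?C = "\<lambda>x. SUP h\<in>T. m h - F h x"
  let ?\<Psi> = "\<lambda>x y. SUP h\<in>T. F h y - F h x"
  have C: "integrable (PiM UNIV \<mu>) ?C"
    using F by (intro integrable_SUP_finite T Bochner_Integration.integrable_diff Q.integrable_const) auto
  have \<Psi>: "integrable (doubled \<mu> (?I \<union> ?J)) (\<lambda>\<omega>. ?\<Psi> (select_copy {} \<omega>) (select_copy UNIV \<omega>))"
    unfolding un using F
    by (intro integrable_SUP_finite T Bochner_Integration.integrable_diff integrable_select_copy) auto
  have merge: "select_copy {} (merge ?I ?J (x, y)) = select_copy {} x"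
    "select_copy UNIV (merge ?I ?J (x, y)) = select_copy UNIV y" for x y :: "'n \<times> bool \<Rightarrow> 'x"
    by (simp_all add: select_copy_def merge_def)
  have inner: "?C x \<le> (\<integral>y. ?\<Psi> x (select_copy UNIV y) \<partial>doubled \<mu> ?J)" for x
  proof (rule cSUP_least[OF T(2)])
    fix h assume h: "h \<in> T"
    have Fint: "integrable (doubled \<mu> ?J) (\<lambda>y. F g (select_copy UNIV y))" if "g \<in> T" for g
      using F[OF that] by (intro integrable_select_copy) auto
    have "m h - F h x = (\<integral>y. F h (select_copy UNIV y) - F h x \<partial>doubled \<mu> ?J)"
      using Fint[OF h] F[OF h] integral_select_copy[of UNIV ?J "F h"]
      by (simp add: m_def J.prob_space)
    also have "\<dots> \<le> (\<integral>y. ?\<Psi> x (select_copy UNIV y) \<partial>doubled \<mu> ?J)"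
      using h Fint T
      by (intro integral_mono integrable_SUP_finite Bochner_Integration.integrable_diff
          J.integrable_const SUP_finite_upper) auto
    finally show "m h - F h x \<le> (\<integral>y. ?\<Psi> x (select_copy UNIV y) \<partial>doubled \<mu> ?J)" .
  qed
  have "(\<integral>x. ?C x \<partial>PiM UNIV \<mu>) = (\<integral>x. ?C (select_copy {} x) \<partial>doubled \<mu> ?I)"
    using C by (intro integral_select_copy[symmetric]) auto
  also have "\<dots> \<le> (\<integral>x. (\<integral>y. ?\<Psi> (select_copy {} (merge ?I ?J (x, y))) (select_copy UNIV (merge ?I ?J (x, y)))
      \<partial>doubled \<mu> ?J) \<partial>doubled \<mu> ?I)"
  proof (rule integral_mono)
    show "integrable (doubled \<mu> ?I) (\<lambda>x. ?C (select_copy {} x))"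
      using C by (intro integrable_select_copy) auto
    show "integrable (doubled \<mu> ?I) (\<lambda>x. \<integral>y. ?\<Psi> (select_copy {} (merge ?I ?J (x, y)))
        (select_copy UNIV (merge ?I ?J (x, y))) \<partial>doubled \<mu> ?J)"
      by (rule integrable_product_fold[OF disj _ _ \<Psi>]) auto
  qed (simp add: merge inner)
  also have "\<dots> = (\<integral>\<omega>. ?\<Psi> (select_copy {} \<omega>) (select_copy UNIV \<omega>) \<partial>doubled \<mu> UNIV)"
    using product_integral_fold[OF disj _ _ \<Psi>] by (simp add: un)
  finally show ?thesis
    unfolding m_def .
qed

lemma integral_SUP_centered_le_average:
  fixes F :: "'h \<Rightarrow> ('n \<Rightarrow> 'x) \<Rightarrow> real"
  assumes T: "finite T" "T \<noteq> {}" and F: "\<And>h. h \<in> T \<Longrightarrow> integrable (PiM UNIV \<mu>) (F h)"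
  shows "(\<integral>x. (SUP h\<in>T. (\<integral>y. F h y \<partial>PiM UNIV \<mu>) - F h x) \<partial>PiM UNIV \<mu>)
       \<le> (\<integral>\<omega>. (\<Sum>A\<in>UNIV. SUP h\<in>T. F h (select_copy A \<omega>) - F h (select_copy (- A) \<omega>)) / 2 ^ CARD('n)
            \<partial>doubled \<mu> UNIV)"
proof -
  let ?\<Psi> = "\<lambda>A \<omega>. SUP h\<in>T. F h (select_copy A \<omega>) - F h (select_copy (- A) \<omega>)"
  have \<Psi>: "integrable (doubled \<mu> UNIV) (?\<Psi> A)" for A
    using F by (intro integrable_SUP_finite T Bochner_Integration.integrable_diff integrable_select_copy) auto
  have "integral\<^sup>L (doubled \<mu> UNIV) (?\<Psi> A) = integral\<^sup>L (doubled \<mu> UNIV) (?\<Psi> UNIV)" for A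
    using integral_swap_copies[of "\<lambda>y x. SUP h\<in>T. F h y - F h x" A] \<Psi>[of UNIV] by simp
  moreover have "CARD('n set) = 2 ^ CARD('n)"
    using card_Pow[of "UNIV :: 'n set"] by simp
  ultimately have "(\<integral>\<omega>. (\<Sum>A\<in>UNIV. ?\<Psi> A \<omega>) / 2 ^ CARD('n) \<partial>doubled \<mu> UNIV)
      = integral\<^sup>L (doubled \<mu> UNIV) (?\<Psi> UNIV)"
    using \<Psi> by simp
  then show ?thesis
    using integral_SUP_centered_le_copies[OF T F] by simp
qed

end

section \<open>Properties of the Gaussian average\<close>

text \<open>
  The two-point contraction with \<open>B = 0\<close> and \<open>d\<close> the rescaled distance to the point \<open>V g\<close>, which is
  Lipschitz by the triangle inequality. In particular a Gaussian average is nonnegative, and it vanishes only for a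
  singleton.
\<close>

lemma gauss_avg_ge_half_distance:
  fixes V :: "'h \<Rightarrow> 'a::euclidean_space"
  assumes T: "finite T" and h: "h \<in> T" "g \<in> T"
  shows "sqrt (2 / pi) * norm (V h - V g) / 2 \<le> gauss_avg (V ` T)"
proof -
  have ne: "T \<noteq> {}" using h by auto
  define d where "d h = sqrt (2 / pi) * norm (V h - V g)" for h
  have "((SUP h\<in>T. 0 + d h) + (SUP h\<in>T. 0 - d h)) / 2
      \<le> (\<integral>x. (SUP h\<in>T. 0 + (\<Sum>b\<in>Basis. (V h \<bullet> b) * x b)) \<partial>gaussian_product Basis)"
  proof (rule two_point_gaussian_contraction[OF finite_Basis T ne])
    fix i j
    have "norm (V i - V g) - norm (V j - V g) \<le> norm (V i - V j)"
      using norm_triangle_ineq2[of "V i - V g" "V j - V g"] by simp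
    moreover have "norm (V i - V j) = sqrt (\<Sum>b\<in>Basis. (V i \<bullet> b - V j \<bullet> b)\<^sup>2)"
      unfolding norm_eq_sqrt_inner by (subst euclidean_inner) (simp add: inner_diff_left power2_eq_square)
    ultimately show "d i - d j \<le> sqrt (2 / pi) * sqrt (\<Sum>b\<in>Basis. (V i \<bullet> b - V j \<bullet> b)\<^sup>2)"
      unfolding d_def by (metis mult_left_mono real_sqrt_ge_zero right_diff_distrib pi_ge_zero zero_le_divide_iff zero_le_numeral)
  qed
  moreover have "d h \<le> (SUP h\<in>T. 0 + d h)" "0 \<le> (SUP h\<in>T. 0 - d h)"
    using SUP_finite_upper[OF T h(1), of d] SUP_finite_upper[OF T h(2), of "\<lambda>h. - d h"]
    by (simp_all add: d_def)
  ultimately show ?thesis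
    unfolding gauss_avg_eq_gaussian_product[OF T ne] d_def[symmetric] by simp
qed

lemma measurable_vec_map:
  fixes h :: "'x \<Rightarrow> 'a::euclidean_space"
  assumes "h \<in> borel_measurable S"
  shows "(\<lambda>x. vec_map h x :: 'a ^ 'n::finite) \<in> borel_measurable (PiM UNIV (\<lambda>_. S))"
proof (subst borel_measurable_euclidean_space, rule ballI)
  fix b :: "'a ^ 'n" assume "b \<in> Basis"
  then obtain i u where b: "b = axis i u"
    by (auto simp: Basis_vec_def)
  have "(\<lambda>x. h (x i) \<bullet> u) \<in> borel_measurable (PiM UNIV (\<lambda>_. S))"
    by (intro borel_measurable_inner borel_measurable_const measurable_compose[OF _ assms]
        measurable_component_singleton) simp
  then show "(\<lambda>x. vec_map h x \<bullet> b) \<in> borel_measurable (PiM UNIV (\<lambda>_. S))"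
    by (simp add: b inner_axis vec_map_def)
qed

lemma measurable_gauss_avg_image:
  fixes V :: "'h \<Rightarrow> 'x \<Rightarrow> 'a::euclidean_space"
  assumes T: "finite T" "T \<noteq> {}" and V: "\<And>h. h \<in> T \<Longrightarrow> V h \<in> borel_measurable M"
  shows "(\<lambda>x. gauss_avg ((\<lambda>h. V h x) ` T)) \<in> borel_measurable M"
proof -
  interpret G: prob_space "gaussian_product (Basis :: 'a set)" by (rule prob_space_gaussian_product)
  have comp: "(\<lambda>g. g b) \<in> borel_measurable (gaussian_product Basis)" if "b \<in> Basis" for b :: 'a
    using borel_measurable_integrable[OF integrable_gaussian_product_component[OF that]] .
  have "(\<lambda>(x, g). SUP h\<in>T. \<Sum>b\<in>Basis. (V h x \<bullet> b) * g b)
      \<in> borel_measurable (M \<Otimes>\<^sub>M gaussian_product (Basis :: 'a set))"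
    unfolding case_prod_beta
    by (intro measurable_SUP_finite T borel_measurable_sum borel_measurable_times borel_measurable_inner
        borel_measurable_const measurable_compose[OF measurable_fst V] measurable_compose[OF measurable_snd comp])
  then show ?thesis
    unfolding gauss_avg_eq_gaussian_product[OF T] by (rule G.borel_measurable_lebesgue_integral)
qed

section \<open>The symmetrization inequality\<close>

lemma ennreal_integral_le_nn_integral:
  fixes g :: "'a \<Rightarrow> real"
  shows "ennreal (\<integral>x. g x \<partial>M) \<le> (\<integral>\<^sup>+x. ennreal (g x) \<partial>M)"
proof (cases "integrable M g")
  case True
  have "(\<integral>x. g x \<partial>M) \<le> (\<integral>x. max 0 (g x) \<partial>M)"
    using True by (intro integral_mono) auto
  then have "ennreal (\<integral>x. g x \<partial>M) \<le> (\<integral>\<^sup>+x. ennreal (max 0 (g x)) \<partial>M)"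
    using True by (subst nn_integral_eq_integral) (auto intro: ennreal_leI)
  moreover have "ennreal (max 0 (g x)) = ennreal (g x)" for x
    by (simp add: max_def ennreal_neg)
  ultimately show ?thesis by simp
next
  case False
  then show ?thesis by (simp add: not_integrable_integral_eq)
qed

theorem theorem2:
  fixes P :: "'w measure"
    and S :: "'x measure"
    and X X' :: "'n::finite \<Rightarrow> 'w \<Rightarrow> 'x"
    and U :: "(real ^ 'd) set"
    and H :: "('x \<Rightarrow> real ^ 'd) set"
    and f :: "real ^ 'd ^ 'n \<Rightarrow> real"
  assumes prob: "prob_space P"
    and X_indep: "prob_space.indep_vars P (\<lambda>_. S) X UNIV"
    and X'_indep: "prob_space.indep_var P
          (\<Pi>\<^sub>M k\<in>UNIV. S) (\<lambda>\<omega> k. X k \<omega>) (\<Pi>\<^sub>M k\<in>UNIV. S) (\<lambda>\<omega> k. X' k \<omega>)"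
    and X'_distr: "distr P (\<Pi>\<^sub>M k\<in>UNIV. S) (\<lambda>\<omega> k. X' k \<omega>)
          = distr P (\<Pi>\<^sub>M k\<in>UNIV. S) (\<lambda>\<omega> k. X k \<omega>)"
    and H_finite: "finite H"
    and H_nonempty: "H \<noteq> {}"
    and H_meas: "\<And>h. h \<in> H \<Longrightarrow> h \<in> measurable S (restrict_space borel U)"
    and f_meas: "f \<in> borel_measurable (restrict_space borel (cart_power U))"
    and f_int: "\<And>h. h \<in> H \<Longrightarrow> integrable P (\<lambda>\<omega>. f (vec_map h (\<lambda>k. X k \<omega>)))"
  shows "ennreal (\<integral>\<omega>. (SUP h\<in>H. (\<integral>\<omega>'. f (vec_map h (\<lambda>k. X' k \<omega>')) \<partial>P)
                              - f (vec_map h (\<lambda>k. X k \<omega>))) \<partial>P)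
         \<le> ennreal (sqrt (2 * pi)) * (2 * M_Lip U f + J_Lip U f)
            * (\<integral>\<^sup>+\<omega>. ennreal (gauss_avg ((\<lambda>h. vec_map h (\<lambda>k. X k \<omega>)) ` H)) \<partial>P)"
proof -
  let ?S = "\<Pi>\<^sub>M k\<in>(UNIV :: 'n set). S" and ?X = "\<lambda>\<omega> k. X k \<omega>" and ?X' = "\<lambda>\<omega> k. X' k \<omega>"
  interpret P: prob_space P by (rule prob)
  define \<mu> where "\<mu> = (\<lambda>k. distr P S (X k))"
  define F where "F h x = f (vec_map h x)" for h and x :: "'n \<Rightarrow> 'x"
  define G where "G x = gauss_avg ((\<lambda>h. vec_map h x :: real ^ 'd ^ 'n) ` H)" for x
  define M where "M = enn2real (M_Lip U f)"
  define J where "J = enn2real (J_Lip U f)"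
  note H = H_finite H_nonempty
  have X[measurable]: "X k \<in> P \<rightarrow>\<^sub>M S" for k
    using X_indep by (auto simp: P.indep_vars_def)
  have mX: "?X \<in> P \<rightarrow>\<^sub>M ?S"
    using measurable_restrict[of UNIV X P "\<lambda>_. S"] X by (simp add: restrict_UNIV)
  have mX': "?X' \<in> P \<rightarrow>\<^sub>M ?S"
    using X'_indep P.indep_var_rv2 by blast
  have \<mu>: "prob_space (\<mu> k)" for k
    unfolding \<mu>_def by (rule P.prob_space_distr) simp
  have sets_\<mu>: "sets (\<mu> k) = sets S" for k
    by (simp add: \<mu>_def)
  have law: "distr P ?S ?X = PiM UNIV \<mu>"
    using X_indep P.indep_vars_iff_distr_eq_PiM[of UNIV X "\<lambda>_. S"] X by (simp add: \<mu>_def restrict_UNIV)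
  have sets_Q: "sets (PiM UNIV \<mu>) = sets ?S"
    by (rule sets_PiM_cong) (simp_all add: sets_\<mu>)
  have h_borel: "h \<in> borel_measurable S" and h_U: "\<And>x. x \<in> space S \<Longrightarrow> h x \<in> U" if "h \<in> H" for h
    using H_meas[OF that] by (auto simp: measurable_restrict_space2_iff)
  have vec_U: "vec_map h x \<in> cart_power U" if "h \<in> H" "\<And>k. x k \<in> space S" for h and x :: "'n \<Rightarrow> 'x"
    using that h_U by (auto simp: vec_map_def cart_power_def)
  have vec_meas: "(\<lambda>x. vec_map h x :: real ^ 'd ^ 'n) \<in> borel_measurable ?S" if "h \<in> H" for h
    by (rule measurable_vec_map[OF h_borel[OF that]])
  have F_meas: "F h \<in> borel_measurable ?S" if h: "h \<in> H" for h
    unfolding F_def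
  proof (rule measurable_compose[OF _ f_meas])
    show "vec_map h \<in> ?S \<rightarrow>\<^sub>M restrict_space borel (cart_power U)"
      using vec_meas[OF h] vec_U[OF h]
      by (intro measurable_restrict_space2) (auto simp: space_PiM)
  qed
  have F_X: "(\<integral>\<omega>. g (?X \<omega>) \<partial>P) = (\<integral>x. g x \<partial>PiM UNIV \<mu>)" if "g \<in> borel_measurable ?S" for g :: "_ \<Rightarrow> real"
    unfolding law[symmetric] by (rule integral_distr[OF mX that, symmetric])
  have F_X': "(\<integral>\<omega>. F h (?X' \<omega>) \<partial>P) = (\<integral>x. F h x \<partial>PiM UNIV \<mu>)" if "h \<in> H" for h
    using integral_distr[OF mX' F_meas[OF that]] by (simp add: X'_distr law)
  have F_int: "integrable (PiM UNIV \<mu>) (F h)" if "h \<in> H" for h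
    using f_int[OF that] integrable_distr_eq[OF mX F_meas[OF that]] by (simp add: law F_def)
  have G_meas: "G \<in> borel_measurable ?S"
    unfolding G_def by (intro measurable_gauss_avg_image H vec_meas)
  have G_ge: "sqrt (2 / pi) * norm (vec_map h x - vec_map g x :: real ^ 'd ^ 'n) / 2 \<le> G x"
    if "h \<in> H" "g \<in> H" for h g x
    unfolding G_def using gauss_avg_ge_half_distance[OF H_finite that, of "\<lambda>h. vec_map h x"] by simp
  have G_nonneg: "0 \<le> G x" for x
    using G_ge[of "SOME h. h \<in> H" "SOME h. h \<in> H" x] H_nonempty by (simp add: some_in_eq)
  define L where "L = (\<integral>x. (SUP h\<in>H. (\<integral>y. F h y \<partial>PiM UNIV \<mu>) - F h x) \<partial>PiM UNIV \<mu>)"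
  have L: "(\<integral>\<omega>. (SUP h\<in>H. (\<integral>\<omega>'. f (vec_map h (?X' \<omega>')) \<partial>P) - f (vec_map h (?X \<omega>))) \<partial>P) = L"
  proof -
    have "(\<lambda>x. SUP h\<in>H. (\<integral>y. F h y \<partial>PiM UNIV \<mu>) - F h x) \<in> borel_measurable ?S"
      by (intro measurable_SUP_finite H borel_measurable_diff borel_measurable_const F_meas)
    from F_X[OF this] show ?thesis
      by (simp add: L_def F_X'[unfolded F_def] F_def cong: SUP_cong_simp)
  qed
  have EG: "(\<integral>\<^sup>+\<omega>. ennreal (gauss_avg ((\<lambda>h. vec_map h (?X \<omega>) :: real ^ 'd ^ 'n) ` H)) \<partial>P)
      = (\<integral>\<^sup>+x. ennreal (G x) \<partial>PiM UNIV \<mu>)"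
    unfolding G_def[symmetric] law[symmetric]
    using G_meas by (intro nn_integral_distr[OF mX, symmetric]) simp
  have "ennreal L \<le> ennreal (sqrt (2 * pi)) * (2 * M_Lip U f + J_Lip U f) * (\<integral>\<^sup>+x. ennreal (G x) \<partial>PiM UNIV \<mu>)"
  proof (cases "(\<integral>\<^sup>+x. ennreal (G x) \<partial>PiM UNIV \<mu>) = 0")
    (* All functions agree on almost every sample, so the supremum is that of a single
       centred variable. This also covers infinite seminorms, where the right-hand side is
       the product of infinity and zero. *)
    case True
    have "AE x in PiM UNIV \<mu>. G x \<le> 0"
      using True G_meas sets_Q by (subst (asm) nn_integral_0_iff_AE) (auto simp: G_nonneg cong: measurable_cong_sets)
    then have eq: "AE x in PiM UNIV \<mu>. \<forall>h\<in>H. \<forall>g\<in>H. F h x = F g x"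
    proof eventually_elim
      case (elim x)
      then have "vec_map h x = (vec_map g x :: real ^ 'd ^ 'n)" if "h \<in> H" "g \<in> H" for h g
      proof -
        have "sqrt (2 / pi) * norm (vec_map h x - vec_map g x :: real ^ 'd ^ 'n) \<le> 0"
          using G_ge[OF that, of x] elim by simp
        then show ?thesis using pi_gt_zero by (simp add: mult_le_0_iff)
      qed
      then show ?case unfolding F_def by metis
    qed
    obtain h0 where h0: "h0 \<in> H" using H_nonempty by blast
    have m: "(\<integral>y. F h y \<partial>PiM UNIV \<mu>) = (\<integral>y. F h0 y \<partial>PiM UNIV \<mu>)" if "h \<in> H" for h
      using eq F_int that h0 by (intro integral_cong_AE) auto
    interpret Q: prob_space "PiM UNIV \<mu>" by (intro prob_space_PiM \<mu>)
    have "L = (\<integral>x. (\<integral>y. F h0 y \<partial>PiM UNIV \<mu>) - F h0 x \<partial>PiM UNIV \<mu>)"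
      unfolding L_def
    proof (intro integral_cong_AE)
      show "(\<lambda>x. SUP h\<in>H. (\<integral>y. F h y \<partial>PiM UNIV \<mu>) - F h x) \<in> borel_measurable (PiM UNIV \<mu>)"
        using F_int by (intro measurable_SUP_finite H) auto
      show "AE x in PiM UNIV \<mu>. (SUP h\<in>H. (\<integral>y. F h y \<partial>PiM UNIV \<mu>) - F h x)
          = (\<integral>y. F h0 y \<partial>PiM UNIV \<mu>) - F h0 x"
        using eq
      proof eventually_elim
        case (elim x)
        then have "(\<integral>y. F h y \<partial>PiM UNIV \<mu>) - F h x = (\<integral>y. F h0 y \<partial>PiM UNIV \<mu>) - F h0 x" if "h \<in> H" for h
          using m[OF that] h0 that by metis
        then show ?case
          using H_nonempty by (simp cong: SUP_cong_simp)
      qed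
    qed (use F_int h0 in auto)
    also have "\<dots> = 0"
      using F_int[OF h0] by (simp add: Q.prob_space)
    finally show ?thesis by simp
  next
    case False
    show ?thesis
    proof (cases "M_Lip U f < \<infinity> \<and> J_Lip U f < \<infinity>")
      case True
      then have fin: "M_Lip U f < \<infinity>" "J_Lip U f < \<infinity>" by auto
      have MJ: "M_Lip U f = ennreal M" "J_Lip U f = ennreal J" and nonneg: "0 \<le> M" "0 \<le> J"
        using fin by (simp_all add: M_def J_def less_top[symmetric])
      define \<kappa> where "\<kappa> = sqrt (pi / 2) * (sqrt 2 * M + J)"
      have \<kappa>: "0 \<le> \<kappa>"
        using nonneg by (simp add: \<kappa>_def)
      let ?R = "doubled \<mu> UNIV"
      define \<Phi> where "\<Phi> \<omega> = (\<Sum>A\<in>UNIV. SUP h\<in>H. F h (select_copy A \<omega>) - F h (select_copy (- A) \<omega>))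
          / 2 ^ CARD('n)" for \<omega>
      have \<Phi>_le: "\<Phi> \<omega> \<le> \<kappa> * (G (select_copy {} \<omega>) + G (select_copy UNIV \<omega>))" if "\<omega> \<in> space ?R" for \<omega>
      proof -
        have \<omega>: "\<omega> p \<in> space S" for p
          using that sets_eq_imp_space_eq[OF sets_\<mu>] by (auto simp: space_PiM PiE_def)
        have mix: "vec_map h (select_copy A \<omega>)
            = mix_coords A (vec_map h (select_copy {} \<omega>)) (vec_map h (select_copy UNIV \<omega>))" for h A
          by (auto simp: mix_coords_def vec_map_def select_copy_def vec_eq_iff)
        have "vec_map h (select_copy A \<omega>) \<in> cart_power U" if "h \<in> H" for h A
          using that by (rule vec_U) (simp add: select_copy_def \<omega>)
        then show ?thesis
          using average_symmetrized_SUP_le[OF fin H, of "\<lambda>h. vec_map h (select_copy {} \<omega>)"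
              "\<lambda>h. vec_map h (select_copy UNIV \<omega>)"]
          unfolding mix[symmetric] \<Phi>_def F_def \<kappa>_def M_def J_def G_def by blast
      qed
      have "L \<le> (\<integral>\<omega>. \<Phi> \<omega> \<partial>?R)"
        unfolding L_def \<Phi>_def by (intro integral_SUP_centered_le_average \<mu> H F_int)
      then have "ennreal L \<le> ennreal (\<integral>\<omega>. \<Phi> \<omega> \<partial>?R)"
        by (rule ennreal_leI)
      also have "\<dots> \<le> (\<integral>\<^sup>+\<omega>. ennreal (\<Phi> \<omega>) \<partial>?R)"
        by (rule ennreal_integral_le_nn_integral)
      also have "\<dots> \<le> (\<integral>\<^sup>+\<omega>. ennreal \<kappa> * (ennreal (G (select_copy {} \<omega>)) + ennreal (G (select_copy UNIV \<omega>))) \<partial>?R)"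
        using \<Phi>_le \<kappa> G_nonneg
        by (intro nn_integral_mono) (simp add: ennreal_leI flip: ennreal_mult ennreal_plus)
      also have "\<dots> = ennreal \<kappa> * (2 * (\<integral>\<^sup>+x. ennreal (G x) \<partial>PiM UNIV \<mu>))"
      proof -
        have GQ: "(\<lambda>x. ennreal (G x)) \<in> borel_measurable (PiM UNIV \<mu>)"
          using G_meas sets_Q by (simp cong: measurable_cong_sets)
        have sel: "select_copy A \<in> ?R \<rightarrow>\<^sub>M PiM UNIV \<mu>" for A
          by (intro measurable_select_copy \<mu>) simp
        have sel_law: "distr ?R (PiM UNIV \<mu>) (select_copy A) = PiM UNIV \<mu>" for A
          by (intro distr_select_copy \<mu>) simp
        have GR: "(\<lambda>\<omega>. ennreal (G (select_copy A \<omega>))) \<in> borel_measurable ?R" for A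
          by (rule measurable_compose[OF sel GQ])
        have "(\<integral>\<^sup>+\<omega>. ennreal (G (select_copy A \<omega>)) \<partial>?R) = (\<integral>\<^sup>+x. ennreal (G x) \<partial>PiM UNIV \<mu>)" for A
          using nn_integral_distr[OF sel, of "\<lambda>x. ennreal (G x)" A] GQ by (simp add: sel_law)
        then show ?thesis
          using GR by (simp add: nn_integral_cmult nn_integral_add mult_2)
      qed
      also have "\<dots> = ennreal (2 * \<kappa>) * (\<integral>\<^sup>+x. ennreal (G x) \<partial>PiM UNIV \<mu>)"
        using \<kappa> by (simp add: ennreal_mult mult_ac)
      also have "\<dots> \<le> ennreal (sqrt (2 * pi) * (2 * M + J)) * (\<integral>\<^sup>+x. ennreal (G x) \<partial>PiM UNIV \<mu>)"
      proof (intro mult_right_mono ennreal_leI)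
        have "2 * sqrt (pi / 2) = sqrt (2 * pi)"
          by (simp add: real_sqrt_mult real_sqrt_divide field_simps)
        moreover have "sqrt 2 * M \<le> 2 * M"
          using nonneg sqrt2_less_2 by (intro mult_right_mono) auto
        ultimately have "2 * \<kappa> \<le> sqrt (2 * pi) * (2 * M + J)"
          unfolding \<kappa>_def by (simp flip: mult.assoc)
        then show "2 * \<kappa> \<le> sqrt (2 * pi) * (2 * M + J)" .
      qed simp
      also have "ennreal (sqrt (2 * pi) * (2 * M + J)) = ennreal (sqrt (2 * pi)) * (2 * M_Lip U f + J_Lip U f)"
        using nonneg by (simp add: MJ ennreal_mult)
      finally show ?thesis .
    next
      case infinite: False
      have top: "2 * M_Lip U f + J_Lip U f = \<infinity>"
        using infinite by (auto simp: not_less top_unique ennreal_mult_eq_top_iff)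
      show ?thesis
        unfolding top using False by (simp add: ennreal_mult_top ennreal_top_mult)
    qed
  qed
  then show ?thesis
    unfolding L EG .
qed

end
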